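(* Consider an interconnection of $n\ge 2$ hybrid subsystems with data $(f_i,g_i,C_i,D_i,\chi_i,U)$, $i=1,\dots,n$, whose jump sets coincide, $D_1=\dots=D_n=:D$, and the resulting overall hybrid system with data $(f,g,C,D,\chi,U)$. Assume that every subsystem is globally pre-stable (pre-GS), with functions $\sigma_i$ and gains $\hat\gamma_{ij},\hat\gamma_i\in\mathcal{K}_\infty\cup\{0\}$. Put $\gamma_{ij}=\hat\gamma_{ij}$ for $i\ne j$ and $\gamma_{ii}\equiv 0$, and let $\Gamma_{\max}:\mathbb{R}^n_+\to\mathbb{R}^n_+$, $(\Gamma_{\max}(s))_i=\max_{j\neq i}\gamma_{ij}(s_j)$. If $$\Gamma_{\max}(s)\not\ge s\qquad\text{for all } s\in\mathbb{R}^n_+,\ s\ne 0,$$ then the overall system is pre-GS, i.e. there exist $\sigma,\hat\gamma\in\mathcal{K}_\infty\cup\{0\}$ such that for all initial values $x_0$ every solution pair $(x,u)\in S_u(x_0)$ of the overall system satisfies, for all $(t,k)\in\mathrm{dom}\,x$, $$|x(t,k)|\le\max\{\sigma(|x_0|),\hat\gamma(\|u\|_{(t,k)})\}.$$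
   Context: Notation. $\mathbb{R}_+=[0,\infty)$, $\mathbb{N}_+=\{0,1,2,\dots\}$, $\mathbb{R}^n_+=\{s\in\mathbb{R}^n: s_i\ge 0\ \forall i\}$. For $x,y\in\mathbb{R}^n$: $x\ge y$ means $x_i\ge y_i$ for all $i$; $x\not\ge y$ means there is $i$ with $x_i<y_i$. A function $\gamma:\mathbb{R}_+\to\mathbb{R}_+$ is of class $\mathcal{K}$ if it is continuous, strictly increasing and $\gamma(0)=0$; of class $\mathcal{K}_\infty$ if moreover unbounded. $0$ in $\mathcal{K}_\infty\cup\{0\}$ is the zero function. Interconnected hybrid systems. Subsystem $i$ has state $x_i\in\chi_i\subset\mathbb{R}^{N_i}$, and there is an external input $u\in U\subset\mathbb{R}^M$. Let $\chi=\chi_1\times\dots\times\chi_n$, $x=(x_1^T,\dots,x_n^T)^T\in\chi\subset\mathbb{R}^N$, $N=\sum N_i$. Subsystem $i$ is $$\dot x_i=f_i(x_1,\dots,x_n,u),\ (x,u)\in C_i;\qquad x_i^+=g_i(x_1,\dots,x_n,u),\ (x,u)\in D_i,$$ with $C_i,D_i\subset\chi\times U$, $f_i:C_i\to\mathbb{R}^{N_i}$, $g_i:D_i\to\chi_i$. Standing regularity assumptions: $\chi_i$ is open, $U$ is closed, $C_i,D_i$ are relatively closed in $\chi\times U$, and $f_i,g_i$ are continuous. Overall system: $\dot x=f(x,u)$ for $(x,u)\in C$, $x^+=g(x,u)$ for $(x,u)\in D$, where $C=\bigcap_i C_i$, $D=\bigcup_i D_i$, $f=(f_1^T,\dots,f_n^T)^T$,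 $g=(\tilde g_1^T,\dots,\tilde g_n^T)^T$ with $\tilde g_i(x,u)=g_i(x,u)$ if $(x,u)\in D_i$ and $\tilde g_i(x,u)=x_i$ otherwise. Hybrid time domains and signals. A hybrid time domain is a subset of $\mathbb{R}_+\times\mathbb{N}_+$ that is a union of finitely or infinitely many intervals $[t_k,t_{k+1}]\times\{k\}$, where $0=t_0\le t_1\le\dots$ is a finite or infinite nondecreasing sequence of reals; the last interval, if it exists, may be of the form $[t_K,T)\times\{K\}$ with $T$ finite or $T=+\infty$. For elements of a hybrid time domain, $(s,l)\le(t,k)$ means $s+l\le t+k$. A hybrid signal is a function on a hybrid time domain. A hybrid input is a hybrid signal $u$ with $u(\cdot,k)$ Lebesgue measurable and locally essentially bounded for each $k$. A hybrid arc is a hybrid signal $x$ with $x(\cdot,k)$ locally absolutely continuous for each $k$. For a hybrid signal $u$ put $\Phi(u)=\{(s,l)\in\mathrm{dom}\,u:(s,l+1)\in\mathrm{dom}\,u\}$ and $$\|u\|_{(t,k)}=\max\Big\{\operatorname*{ess\,sup}_{(s,l)\in\mathrm{dom}\,u\setminus\Phi(u),\,(s,l)\le(t,k)}|u(s,l)|,\ \sup_{(s,l)\in\Phi(u),\,(s,l)\le(t,k)}|u(s,l)|\Big\}.$$ Solutions. For subsystem $i$ the input is $v_i=(x_1^T,\dots,x_{i-1}^T,x_{i+1}^T,\dots,x_n^T,u^T)^T$, made of hybrid inputs $x_j:\mathrm{dom}\,x_j\to\chi_j$ ($j\ne i$) and $u:\mathrm{dom}\,u\to U$. A pair $(x_i,v_i)$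 with $x_i$ a hybrid arc with values in $\chi_i$ is a solution pair of subsystem $i$ if: (i) $\mathrm{dom}\,x_i=\mathrm{dom}\,u=\mathrm{dom}\,x_j$ for $j\ne i$, and $(x(0,0),u(0,0))\in C_i\cup D_i$; (ii) for all $k\in\mathbb{N}_+$ and almost all $t$ with $(t,k)\in\mathrm{dom}\,x_i$: $(x(t,k),u(t,k))\in C_i$ and $\dot x_i(t,k)=f_i(x(t,k),u(t,k))$; (iii) for all $(t,k)\in\mathrm{dom}\,x_i$ with $(t,k+1)\in\mathrm{dom}\,x_i$: $(x(t,k),u(t,k))\in D_i$ and $x_i(t,k+1)=g_i(x(t,k),u(t,k))$. Solution pairs $(x,u)$ of the overall system are defined in the same way with $f,g,C,D$. A solution pair is maximal if it cannot be extended. $S_{v_i}(x_{i0})$ (resp. $S_u(x_0)$) is the set of maximal solution pairs of subsystem $i$ (resp. of the overall system) with $x_i(0,0)=x_{i0}$ (resp. $x(0,0)=x_0$). pre-GS. Subsystem $i$ is globally pre-stable (pre-GS) if there are $\sigma_i,\hat\gamma_{ij},\hat\gamma_i\in\mathcal{K}_\infty\cup\{0\}$ such that for all initial values $x_{i0}$ each solution pair $(x_i,v_i)\in S_{v_i}(x_{i0})$ satisfies for all $(t,k)\in\mathrm{dom}\,x_i$ $$|x_i(t,k)|\le\max\{\sigma_i(|x_{i0}|),\max_{j\ne i}\hat\gamma_{ij}(\|x_j\|_{(t,k)}),\hat\gamma_i(\|u\|_{(t,k)})\}.$$ *)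

theory Defs
  imports "HOL-Analysis.Analysis" "HOL-Probability.Essential_Supremum"
begin

section \<open>Comparison functions\<close>

text \<open>Functions on \<open>[0,\<infinity>)\<close> are represented by functions on the reals of which only the
  restriction to \<open>{0..}\<close> matters; nonnegativity of the values follows from monotonicity.\<close>

definition class_K :: "(real \<Rightarrow> real) \<Rightarrow> bool" where
  "class_K \<gamma> \<longleftrightarrow> continuous_on {0..} \<gamma> \<and> strict_mono_on {0..} \<gamma> \<and> \<gamma> 0 = 0"

definition class_Kinf :: "(real \<Rightarrow> real) \<Rightarrow> bool" where
  "class_Kinf \<gamma> \<longleftrightarrow> class_K \<gamma> \<and> \<not> bdd_above (\<gamma> ` {0..})"

definition class_Kinf0 :: "(real \<Rightarrow> real) \<Rightarrow> bool" where
  "class_Kinf0 \<gamma> \<longleftrightarrow> class_Kinf \<gamma> \<or> (\<forall>r\<ge>0. \<gamma> r = 0)"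


section \<open>Hybrid time domains and hybrid signals\<close>

text \<open>The three alternatives are: infinitely many closed intervals; finitely many closed
  intervals; finitely many intervals the last of which is nonempty and right-open, with a finite
  or infinite right end. In the last two cases only an initial part of \<open>t\<close> is used.\<close>

definition hybrid_time_domain :: "(real \<times> nat) set \<Rightarrow> bool" where
  "hybrid_time_domain E \<longleftrightarrow>
     (\<exists>t :: nat \<Rightarrow> real. t 0 = 0 \<and> mono t \<and>
        (E = (\<Union>k. {t k..t (Suc k)} \<times> {k})
         \<or> (\<exists>K. E = (\<Union>k\<le>K. {t k..t (Suc k)} \<times> {k}))
         \<or> (\<exists>K T. ereal (t K) < T \<and>
               E = (\<Union>k<K. {t k..t (Suc k)} \<times> {k}) \<union> {s. t K \<le> s \<and> ereal s < T} \<times> {K})))"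

text \<open>A hybrid signal is a partial map whose domain is a hybrid time domain, so that
  \<open>\<subseteq>\<^sub>m\<close> is extension of signals.\<close>

type_synonym 'a hybrid_signal = "real \<times> nat \<rightharpoonup> 'a"

definition is_hybrid_signal :: "'a hybrid_signal \<Rightarrow> bool" where
  "is_hybrid_signal x \<longleftrightarrow> hybrid_time_domain (dom x)"

definition level :: "'a hybrid_signal \<Rightarrow> nat \<Rightarrow> real set" where
  "level x k = {t. (t, k) \<in> dom x}"

abbreviation val :: "'a hybrid_signal \<Rightarrow> real \<Rightarrow> nat \<Rightarrow> 'a" where
  "val x t k \<equiv> the (x (t, k))"

definition hybrid_input :: "'a::euclidean_space hybrid_signal \<Rightarrow> bool" where
  "hybrid_input u \<longleftrightarrow> is_hybrid_signal u \<and>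
     (\<forall>k. (\<lambda>t. val u t k) \<in> borel_measurable (lebesgue_on (level u k)) \<and>
          (\<forall>J. compact J \<and> J \<subseteq> level u k \<longrightarrow>
             (\<exists>B. AE t in lebesgue_on J. norm (val u t k) \<le> B)))"

definition abs_cont_on :: "real \<Rightarrow> real \<Rightarrow> (real \<Rightarrow> 'a::real_normed_vector) \<Rightarrow> bool" where
  "abs_cont_on a b h \<longleftrightarrow>
     (\<forall>e>0. \<exists>d>0. \<forall>\<D>. \<D> division_of \<Union>\<D> \<and> \<Union>\<D> \<subseteq> {a..b} \<and> (\<Sum>I\<in>\<D>. measure lborel I) < d \<longrightarrow>
        (\<Sum>I\<in>\<D>. norm (h (Sup I) - h (Inf I))) < e)"

definition hybrid_arc :: "'a::real_normed_vector hybrid_signal \<Rightarrow> bool" where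
  "hybrid_arc x \<longleftrightarrow> is_hybrid_signal x \<and>
     (\<forall>k a b. {a..b} \<subseteq> level x k \<longrightarrow> abs_cont_on a b (\<lambda>t. val x t k))"

definition jump_times :: "'a hybrid_signal \<Rightarrow> (real \<times> nat) set" where
  "jump_times u = {(s, l). (s, l) \<in> dom u \<and> (s, Suc l) \<in> dom u}"

text \<open>The essential supremum refers to the Lebesgue measure on each level of the domain, and over
  the disjoint union of the levels it is the supremum of the levelwise ones. It is taken in
  \<open>ennreal\<close>, so suprema over empty or null sets are \<open>0\<close>. For hybrid inputs and hybrid arcs the
  value is finite at every point of the domain, so that \<open>enn2real\<close> loses nothing.\<close>

definition hybrid_norm :: "'a::euclidean_space hybrid_signal \<Rightarrow> real \<Rightarrow> nat \<Rightarrow> real" where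
  "hybrid_norm u t k = enn2real (max
     (SUP l. esssup
        (lebesgue_on {s. (s, l) \<in> dom u - jump_times u \<and> s + real l \<le> t + real k})
        (\<lambda>s. ennreal (norm (val u s l))))
     (SUP (s, l) \<in> {(s, l) \<in> jump_times u. s + real l \<le> t + real k}.
        ennreal (norm (val u s l))))"


section \<open>Hybrid systems with inputs and their solution pairs\<close>

record ('x, 'v) hybrid_system =
  state_space :: "'x set"
  input_space :: "'v set"
  flow_set :: "('x \<times> 'v) set"
  jump_set :: "('x \<times> 'v) set"
  flow_map :: "'x \<times> 'v \<Rightarrow> 'x"
  jump_map :: "'x \<times> 'v \<Rightarrow> 'x"

definition solution_pair ::
    "('x::euclidean_space, 'v::euclidean_space) hybrid_system
      \<Rightarrow> 'x hybrid_signal \<Rightarrow> 'v hybrid_signal \<Rightarrow> bool" where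
  "solution_pair S x v \<longleftrightarrow>
     hybrid_arc x \<and> ran x \<subseteq> state_space S \<and>
     hybrid_input v \<and> ran v \<subseteq> input_space S \<and>
     dom x = dom v \<and> (val x 0 0, val v 0 0) \<in> flow_set S \<union> jump_set S \<and>
     (\<forall>k. AE t in lebesgue. (t, k) \<in> dom x \<longrightarrow>
        (val x t k, val v t k) \<in> flow_set S \<and>
        ((\<lambda>\<tau>. val x \<tau> k) has_vector_derivative flow_map S (val x t k, val v t k))
           (at t within level x k)) \<and>
     (\<forall>t k. (t, k) \<in> dom x \<and> (t, Suc k) \<in> dom x \<longrightarrow>
        (val x t k, val v t k) \<in> jump_set S \<and>
        val x t (Suc k) = jump_map S (val x t k, val v t k))"

definition maximal_solution_pair ::
    "('x::euclidean_space, 'v::euclidean_space) hybrid_system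
      \<Rightarrow> 'x hybrid_signal \<Rightarrow> 'v hybrid_signal \<Rightarrow> bool" where
  "maximal_solution_pair S x v \<longleftrightarrow> solution_pair S x v \<and>
     (\<forall>x' v'. solution_pair S x' v' \<and> x \<subseteq>\<^sub>m x' \<and> v \<subseteq>\<^sub>m v' \<longrightarrow> x' = x \<and> v' = v)"

definition solutions_from ::
    "('x::euclidean_space, 'v::euclidean_space) hybrid_system
      \<Rightarrow> 'x \<Rightarrow> ('x hybrid_signal \<times> 'v hybrid_signal) set" where
  "solutions_from S \<xi> = {(x, v). maximal_solution_pair S x v \<and> val x 0 0 = \<xi>}"


section \<open>Interconnections\<close>

text \<open>The subsystems are indexed by the finite type \<open>'n\<close>, and the coordinates of the overall state
  space \<open>\<real>\<^sup>N\<close> by the finite type \<open>'m\<close>. The function \<open>owner\<close> assigns to each coordinate the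
  subsystem it belongs to, so \<open>N\<^sub>i\<close> is the number of coordinates owned by \<open>i\<close>. The space of the
  \<open>i\<close>-th subsystem is the coordinate subspace \<open>block_space b i\<close>, an isometric copy of the Euclidean
  space of dimension \<open>N\<^sub>i\<close>. The inputs live in \<open>\<real>\<^sup>M\<close> with \<open>M = CARD('p)\<close>.\<close>

record ('m, 'n, 'p) network =
  owner :: "'m \<Rightarrow> 'n"
  substates :: "'n \<Rightarrow> (real^'m) set"
  inputs :: "(real^'p) set"
  flow_sets :: "'n \<Rightarrow> ((real^'m) \<times> (real^'p)) set"
  jump_sets :: "'n \<Rightarrow> ((real^'m) \<times> (real^'p)) set"
  flow_maps :: "'n \<Rightarrow> (real^'m) \<times> (real^'p) \<Rightarrow> real^'m"
  jump_maps :: "'n \<Rightarrow> (real^'m) \<times> (real^'p) \<Rightarrow> real^'m"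

definition block_space :: "('m::finite \<Rightarrow> 'n) \<Rightarrow> 'n \<Rightarrow> (real^'m) set" where
  "block_space b i = {x. \<forall>c. b c \<noteq> i \<longrightarrow> x $ c = 0}"

definition block :: "('m::finite \<Rightarrow> 'n) \<Rightarrow> 'n \<Rightarrow> real^'m \<Rightarrow> real^'m" where
  "block b i x = (\<chi> c. if b c = i then x $ c else 0)"

definition stack :: "('m::finite \<Rightarrow> 'n) \<Rightarrow> ('n \<Rightarrow> real^'m) \<Rightarrow> real^'m" where
  "stack b y = (\<chi> c. y (b c) $ c)"

definition states :: "('m::finite, 'n, 'p::finite) network \<Rightarrow> (real^'m) set" where
  "states W = {x. \<forall>i. block (owner W) i x \<in> substates W i}"

definition hybrid_network :: "('m::finite, 'n::finite, 'p::finite) network \<Rightarrow> bool" where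
  "hybrid_network W \<longleftrightarrow>
     closed (inputs W) \<and>
     (\<forall>i. openin (top_of_set (block_space (owner W) i)) (substates W i) \<and>
          closedin (top_of_set (states W \<times> inputs W)) (flow_sets W i) \<and>
          closedin (top_of_set (states W \<times> inputs W)) (jump_sets W i) \<and>
          continuous_on (flow_sets W i) (flow_maps W i) \<and>
          flow_maps W i ` flow_sets W i \<subseteq> block_space (owner W) i \<and>
          continuous_on (jump_sets W i) (jump_maps W i) \<and>
          jump_maps W i ` jump_sets W i \<subseteq> substates W i)"

text \<open>The input of subsystem \<open>i\<close> consists of the states of the other subsystems and the external
  input. The former are stacked into a single vector \<open>w\<close> whose \<open>i\<close>-th block is zero, so that
  \<open>y + w\<close> is the overall state if \<open>y\<close> is the state of subsystem \<open>i\<close>.\<close>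

definition subsystem ::
    "('m::finite, 'n::finite, 'p::finite) network \<Rightarrow> 'n
      \<Rightarrow> (real^'m, (real^'m) \<times> (real^'p)) hybrid_system" where
  "subsystem W i =
     \<lparr> state_space = substates W i,
       input_space = {(w, u). block (owner W) i w = 0 \<and>
                        (\<forall>j. j \<noteq> i \<longrightarrow> block (owner W) j w \<in> substates W j) \<and> u \<in> inputs W},
       flow_set = {(y, (w, u)). (y + w, u) \<in> flow_sets W i},
       jump_set = {(y, (w, u)). (y + w, u) \<in> jump_sets W i},
       flow_map = (\<lambda>(y, (w, u)). flow_maps W i (y + w, u)),
       jump_map = (\<lambda>(y, (w, u)). jump_maps W i (y + w, u)) \<rparr>"

definition overall ::
    "('m::finite, 'n::finite, 'p::finite) network \<Rightarrow> (real^'m, real^'p) hybrid_system" where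
  "overall W =
     \<lparr> state_space = states W,
       input_space = inputs W,
       flow_set = (\<Inter>i. flow_sets W i),
       jump_set = (\<Union>i. jump_sets W i),
       flow_map = (\<lambda>z. stack (owner W) (\<lambda>i. flow_maps W i z)),
       jump_map = (\<lambda>(x, u). stack (owner W)
                     (\<lambda>i. if (x, u) \<in> jump_sets W i then jump_maps W i (x, u)
                          else block (owner W) i x)) \<rparr>"


section \<open>Global pre-stability\<close>

definition neighbour_signal ::
    "('m::finite, 'n::finite, 'p::finite) network \<Rightarrow> 'n
      \<Rightarrow> ((real^'m) \<times> (real^'p)) hybrid_signal \<Rightarrow> (real^'m) hybrid_signal" where
  "neighbour_signal W j v = map_option (\<lambda>(w, u). block (owner W) j w) \<circ> v"

definition external_signal ::
    "((real^'m) \<times> (real^'p)) hybrid_signal \<Rightarrow> (real^'p) hybrid_signal" where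
  "external_signal v = map_option snd \<circ> v"

text \<open>The maximum over \<open>j \<noteq> i\<close> is over a nonempty set as soon as there are at least two
  subsystems.\<close>

definition subsystem_pre_GS ::
    "('m::finite, 'n::finite, 'p::finite) network \<Rightarrow> 'n \<Rightarrow> (real \<Rightarrow> real)
      \<Rightarrow> ('n \<Rightarrow> real \<Rightarrow> real) \<Rightarrow> (real \<Rightarrow> real) \<Rightarrow> bool" where
  "subsystem_pre_GS W i \<sigma> \<gamma> \<gamma>u \<longleftrightarrow>
     class_Kinf0 \<sigma> \<and> (\<forall>j. j \<noteq> i \<longrightarrow> class_Kinf0 (\<gamma> j)) \<and> class_Kinf0 \<gamma>u \<and>
     (\<forall>\<xi> \<in> substates W i. \<forall>(x, v) \<in> solutions_from (subsystem W i) \<xi>. \<forall>(t, k) \<in> dom x.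
        norm (val x t k) \<le>
          max (\<sigma> (norm \<xi>))
            (max (MAX j \<in> UNIV - {i}. \<gamma> j (hybrid_norm (neighbour_signal W j v) t k))
                 (\<gamma>u (hybrid_norm (external_signal v) t k))))"

definition overall_pre_GS ::
    "('m::finite, 'n::finite, 'p::finite) network
      \<Rightarrow> (real \<Rightarrow> real) \<Rightarrow> (real \<Rightarrow> real) \<Rightarrow> bool" where
  "overall_pre_GS W \<sigma> \<gamma> \<longleftrightarrow>
     class_Kinf0 \<sigma> \<and> class_Kinf0 \<gamma> \<and>
     (\<forall>\<xi> \<in> states W. \<forall>(x, u) \<in> solutions_from (overall W) \<xi>. \<forall>(t, k) \<in> dom x.
        norm (val x t k) \<le> max (\<sigma> (norm \<xi>)) (\<gamma> (hybrid_norm u t k)))"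

definition gain_matrix :: "('n \<Rightarrow> 'n \<Rightarrow> real \<Rightarrow> real) \<Rightarrow> 'n \<Rightarrow> 'n \<Rightarrow> real \<Rightarrow> real" where
  "gain_matrix \<gamma>h i j = (if i = j then (\<lambda>_. 0) else \<gamma>h i j)"

definition Gamma_max :: "('n \<Rightarrow> 'n \<Rightarrow> real \<Rightarrow> real) \<Rightarrow> real^'n \<Rightarrow> real^('n::finite)" where
  "Gamma_max \<gamma> s = (\<chi> i. MAX j \<in> UNIV - {i}. \<gamma> i j (s $ j))"

end

theory Submission
  imports Defs
begin

text \<open>If the blocks of a maximal solution pair of the interconnection satisfy the estimates of the
  subsystems, then the norms \<open>s\<^sub>i = \<parallel>x\<^sub>i\<parallel>\<close> satisfy \<open>s \<le> max (\<Gamma> s) c\<close>, where \<open>c\<close> collects the terms of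
  the initial state and of the external input, and the small-gain condition turns this into
  \<open>s\<^sub>i \<le> g\<^sup>n c\<close> for a function \<open>g\<close> dominating the identity and all gains. However, the estimates are
  only available for maximal solution pairs of the subsystems, and the blocks need not be maximal. By
  Zorn's lemma they extend to maximal ones, and it remains to see that this does not increase the
  norms on the original domain. A point enters the norm differently only if it becomes a jump time,
  that is, if the subsystem can jump at the end of the domain. As the jump sets coincide, the whole
  interconnection could then jump as well, contrary to the maximality of its solution pair.\<close>

section \<open>Comparison functions and the small-gain estimate\<close>

text \<open>The coincidence of the jump sets already decides whether a block is a solution pair at
  all: an overall jump keeps every block outside its own jump set unchanged, whereas a solution of a
  subsystem may jump only inside its jump set and along its jump map. Becoming a jump time matters
  for a measure-theoretic reason. A single point of a level is Lebesgue null, so the essential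
  supremum ignores the value there, but a jump time is counted pointwise. Measurability of
  \<open>u\<close> gives no control of such a value, and on a last level consisting of one point
  even the value of the state is invisible to the norm. For the same reason the norm of a block up
  to \<open>(t, k)\<close> need not bound its value at \<open>(t, k)\<close>. The subsystem estimate
  is therefore used a second time at that point, which costs one application of \<open>g\<close>
  beyond the small-gain bound. Apart from jump times the extensions are harmless: a subsystem may
  continue in any way, but each new point comes later than the whole original domain in the order by
  \<open>s + l\<close>.\<close>

lemma class_KinfD:
  assumes "class_Kinf f"
  shows "continuous_on {0..} f" "\<And>a b. 0 \<le> a \<Longrightarrow> a < b \<Longrightarrow> f a < f b" "f 0 = 0"
    "\<exists>r\<ge>0. B < f r"
proof -
  show "continuous_on {0..} f" "f 0 = 0"
    using assms by (auto simp: class_Kinf_def class_K_def)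
  show "f a < f b" if "0 \<le> a" "a < b" for a b
    using assms that by (auto simp: class_Kinf_def class_K_def strict_mono_on_def)
  have "\<not> (\<forall>y\<in>f ` {0..}. y \<le> B)"
    using assms by (auto simp: class_Kinf_def bdd_above_def)
  then show "\<exists>r\<ge>0. B < f r"
    by (auto simp: not_le)
qed

lemma class_KinfI:
  assumes "continuous_on {0..} f" "\<And>a b. 0 \<le> a \<Longrightarrow> a < b \<Longrightarrow> f a < f b" "f 0 = 0"
    "\<And>B. \<exists>r\<ge>0. B < f r"
  shows "class_Kinf f"
proof -
  have "\<not> bdd_above (f ` {0..})"
    using assms(4) unfolding bdd_above_def by (auto simp: not_le)
  then show ?thesis
    using assms(1-3) by (auto simp: class_Kinf_def class_K_def strict_mono_on_def)
qed

lemma class_Kinf0_mono: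
  assumes "class_Kinf0 f" "0 \<le> a" "a \<le> b"
  shows "f a \<le> f b"
  using assms class_KinfD(2)[of f a b] by (cases "a = b") (auto simp: class_Kinf0_def)

lemma class_Kinf0_zero: "class_Kinf0 f \<Longrightarrow> f 0 = 0"
  using class_KinfD(3) by (auto simp: class_Kinf0_def)

lemma class_Kinf0_nonneg: "class_Kinf0 f \<Longrightarrow> 0 \<le> r \<Longrightarrow> 0 \<le> f r"
  using class_Kinf0_mono[of f 0 r] class_Kinf0_zero[of f] by simp

lemma class_Kinf0_continuous: "class_Kinf0 f \<Longrightarrow> continuous_on {0..} f"
  unfolding class_Kinf0_def
  by (auto intro: class_KinfD continuous_on_eq[OF continuous_on_const])

lemma class_Kinf_imp_Kinf0: "class_Kinf f \<Longrightarrow> class_Kinf0 f"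
  by (simp add: class_Kinf0_def)

lemma class_Kinf_id: "class_Kinf (\<lambda>r. r)"
proof (rule class_KinfI)
  show "\<exists>r\<ge>0. B < r" for B :: real
    by (rule exI[of _ "\<bar>B\<bar> + 1"]) auto
qed auto

text \<open>Strict growth and unboundedness come from \<open>f\<close> alone, so \<open>g\<close>
  may be the zero function. Adding the identity thus turns gains that may vanish into members of
  \<open>class_Kinf\<close>.\<close>

lemma class_Kinf_add:
  assumes f: "class_Kinf f" and g: "class_Kinf0 g"
  shows "class_Kinf (\<lambda>r. f r + g r)"
proof (rule class_KinfI)
  show "continuous_on {0..} (\<lambda>r. f r + g r)"
    by (intro continuous_on_add class_KinfD(1)[OF f] class_Kinf0_continuous[OF g])
  show "f a + g a < f b + g b" if "0 \<le> a" "a < b" for a b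
    using class_KinfD(2)[OF f that] class_Kinf0_mono[OF g that(1), of b] that by simp
  show "f 0 + g 0 = 0"
    using class_KinfD(3)[OF f] class_Kinf0_zero[OF g] by simp
  show "\<exists>r\<ge>0. B < f r + g r" for B
  proof -
    obtain r where "r \<ge> 0" "B < f r"
      using class_KinfD(4)[OF f] by blast
    then show ?thesis
      using class_Kinf0_nonneg[OF g, of r] by (intro exI[of _ r]) auto
  qed
qed

lemma class_Kinf_add_sum:
  assumes "finite I" "class_Kinf f" "\<And>i. i \<in> I \<Longrightarrow> class_Kinf0 (g i)"
  shows "class_Kinf (\<lambda>r. f r + (\<Sum>i\<in>I. g i r))"
  using assms(1,3)
proof (induction I rule: finite_induct)
  case empty
  then show ?case
    using assms(2) by simp
next
  case (insert i I)
  then have "class_Kinf (\<lambda>r. (f r + (\<Sum>i\<in>I. g i r)) + g i r)"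
    by (intro class_Kinf_add[of "\<lambda>r. f r + (\<Sum>i\<in>I. g i r)"]) auto
  then show ?case
    using insert.hyps by (simp add: add_ac)
qed

lemma class_Kinf_compose:
  assumes f: "class_Kinf f" and g: "class_Kinf g"
  shows "class_Kinf (\<lambda>r. f (g r))"
proof (rule class_KinfI)
  have nonneg: "0 \<le> g r" if "0 \<le> r" for r
    using class_Kinf0_nonneg[OF class_Kinf_imp_Kinf0[OF g] that] .
  show "continuous_on {0..} (\<lambda>r. f (g r))"
    using nonneg
    by (intro continuous_on_compose2[OF class_KinfD(1)[OF f] class_KinfD(1)[OF g]]) auto
  show "f (g a) < f (g b)" if "0 \<le> a" "a < b" for a b
    using that by (intro class_KinfD(2)[OF f] class_KinfD(2)[OF g] nonneg)
  show "f (g 0) = 0"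
    using class_KinfD(3)[OF f] class_KinfD(3)[OF g] by simp
  show "\<exists>r\<ge>0. B < f (g r)" for B
  proof -
    obtain y where y: "y \<ge> 0" "B < f y"
      using class_KinfD(4)[OF f] by blast
    obtain r where r: "r \<ge> 0" "y < g r"
      using class_KinfD(4)[OF g] by blast
    have "f y < f (g r)"
      using class_KinfD(2)[OF f] y r by blast
    then show ?thesis
      using y r by (intro exI[of _ r]) auto
  qed
qed

lemma class_Kinf_funpow: "class_Kinf f \<Longrightarrow> class_Kinf (f ^^ k)"
  by (induction k) (auto simp: class_Kinf_id id_def comp_def intro: class_Kinf_compose)

lemma class_Kinf_scale:
  assumes f: "class_Kinf f" and c: "0 < c"
  shows "class_Kinf (\<lambda>r. c * f r)"
proof (rule class_KinfI)
  show "continuous_on {0..} (\<lambda>r. c * f r)"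
    by (intro continuous_on_mult_left class_KinfD(1)[OF f])
  show "c * f a < c * f b" if "0 \<le> a" "a < b" for a b
    using class_KinfD(2)[OF f that] c by simp
  show "c * f 0 = 0"
    using class_KinfD(3)[OF f] by simp
  show "\<exists>r\<ge>0. B < c * f r" for B
    using class_KinfD(4)[OF f, of "B / c"] c by (auto simp: field_simps)
qed

lemma class_Kinf0_max:
  assumes "class_Kinf0 f" "0 \<le> a" "0 \<le> b"
  shows "f (max a b) = max (f a) (f b)"
  using class_Kinf0_mono[OF assms(1,2), of b] class_Kinf0_mono[OF assms(1,3), of a]
  by (auto simp: max_def)

text \<open>Maxima over the indices other than \<open>i\<close> can be estimated only over a
  nonempty set; this is where the presence of two subsystems enters.\<close>

lemma UNIV_diff_singleton_nonempty:
  assumes "CARD('n::finite) \<ge> 2"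
  shows "UNIV - {i :: 'n} \<noteq> {}"
proof
  assume "UNIV - {i} = {}"
  then have "(UNIV :: 'n set) = {i}"
    by auto
  then have "CARD('n) = 1"
    by (metis card_1_singleton_iff One_nat_def)
  then show False
    using assms by simp
qed

text \<open>The sets \<open>A k = {i. s\<^sub>i \<le> g\<^sup>k b}\<close> grow strictly until they exhaust the index set: if
  \<open>A (k + 1) = A k\<close>, then replacing \<open>s\<close> by zero on \<open>A k\<close> yields a vector violating the small-gain
  condition.\<close>

lemma small_gain_bound:
  fixes \<gamma> :: "'n::finite \<Rightarrow> 'n \<Rightarrow> real \<Rightarrow> real" and s :: "real^'n"
  assumes card: "CARD('n) \<ge> 2"
    and \<gamma>: "\<And>i j. j \<noteq> i \<Longrightarrow> class_Kinf0 (\<gamma> i j)"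
    and small_gain: "\<And>s :: real^'n. (\<forall>i. 0 \<le> s $ i) \<Longrightarrow> s \<noteq> 0 \<Longrightarrow>
           \<exists>i. Gamma_max (gain_matrix \<gamma>) s $ i < s $ i"
    and g: "class_Kinf g" "\<And>r. 0 \<le> r \<Longrightarrow> r \<le> g r"
      "\<And>i j r. j \<noteq> i \<Longrightarrow> 0 \<le> r \<Longrightarrow> \<gamma> i j r \<le> g r"
    and s: "\<And>i. 0 \<le> s $ i" and b: "0 \<le> b"
    and le: "\<And>i. s $ i \<le> max b (MAX j \<in> UNIV - {i}. \<gamma> i j (s $ j))"
  shows "s $ i \<le> (g ^^ CARD('n)) b"
proof -
  note nonempty = UNIV_diff_singleton_nonempty[OF card]
  define A where "A k = {i. s $ i \<le> (g ^^ k) b}" for k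
  have gk_nonneg: "0 \<le> (g ^^ k) b" for k
    using class_Kinf0_nonneg[OF class_Kinf_imp_Kinf0[OF class_Kinf_funpow[OF g(1)]] b] .
  have gk_ge: "b \<le> (g ^^ k) b" for k
  proof (induction k)
    case (Suc k)
    then show ?case
      using g(2)[OF gk_nonneg[of k]] by simp
  qed simp
  have A_mono: "A k \<subseteq> A (Suc k)" for k
    using g(2)[OF gk_nonneg[of k]] by (auto simp: A_def)
  have A_strict: "A k \<noteq> A (Suc k)" if not_all: "A k \<noteq> UNIV" for k
  proof
    assume eq: "A k = A (Suc k)"
    define z :: "real^'n" where "z = (\<chi> i. if i \<in> A k then 0 else s $ i)"
    obtain m where m: "m \<notin> A k"
      using not_all by auto
    have "z $ m \<noteq> 0"
      using m gk_nonneg[of k] by (auto simp: z_def A_def)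
    then have "z \<noteq> 0"
      by auto
    moreover have "\<forall>i. 0 \<le> z $ i"
      by (simp add: z_def s)
    ultimately obtain i where i: "Gamma_max (gain_matrix \<gamma>) z $ i < z $ i"
      using small_gain by blast
    have i_less: "\<gamma> i j (z $ j) < z $ i" if "j \<noteq> i" for j
    proof -
      have "gain_matrix \<gamma> i j (z $ j) \<le> Gamma_max (gain_matrix \<gamma>) z $ i"
        using that by (auto simp: Gamma_max_def intro!: Max_ge)
      then show ?thesis
        using i that by (simp add: gain_matrix_def)
    qed
    \<comment> \<open>A second index bounds the maximum from below by a nonnegative gain, so
      \<open>z $ i\<close> is positive and \<open>i\<close> is not among the coordinates set to
      zero.\<close>
    obtain j0 where "j0 \<noteq> i"
      using nonempty[of i] by auto
    then have "0 < z $ i"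
      using i_less[of j0] class_Kinf0_nonneg[OF \<gamma>, of j0 i "z $ j0"] \<open>\<forall>i. 0 \<le> z $ i\<close>
      by (meson le_less_trans)
    then have iA: "i \<notin> A k" and zi: "z $ i = s $ i"
      by (auto simp: z_def split: if_splits)
    \<comment> \<open>The assumed stagnation enters here: an index outside \<open>A k\<close> is
      also outside \<open>A (Suc k)\<close>. The additional application of \<open>g\<close> is what
      absorbs a gain evaluated at a coordinate in \<open>A k\<close>; at the other coordinates
      \<open>z\<close> and \<open>s\<close> agree.\<close>
    have si: "(g ^^ Suc k) b < s $ i"
      using iA unfolding eq by (auto simp: A_def)
    have "\<gamma> i j (s $ j) < s $ i" if j: "j \<noteq> i" for j
    proof (cases "j \<in> A k")
      case True
      then have "\<gamma> i j (s $ j) \<le> \<gamma> i j ((g ^^ k) b)"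
        by (intro class_Kinf0_mono[OF \<gamma>[OF j]] s) (auto simp: A_def)
      also have "\<dots> \<le> (g ^^ Suc k) b"
        using g(3)[OF j gk_nonneg[of k]] by simp
      finally show ?thesis
        using si by simp
    next
      case False
      then show ?thesis
        using i_less[OF j] zi by (simp add: z_def)
    qed
    then have "(MAX j \<in> UNIV - {i}. \<gamma> i j (s $ j)) < s $ i"
      using nonempty[of i] by (subst Max_less_iff) auto
    moreover have "b < s $ i"
      using si gk_ge[of "Suc k"] by simp
    ultimately show False
      using le[of i] by simp
  qed
  \<comment> \<open>\<open>A 0\<close> may be empty and each step adds at least one index, so as
    many steps as there are indices suffice. This is the exponent in the claim.\<close>
  have "k \<le> card (A k)" if "k \<le> CARD('n)" for k
    using that
  proof (induction k)
    case (Suc k)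
    show ?case
    proof (cases "A k = UNIV")
      case True
      then have "A (Suc k) = UNIV"
        using A_mono[of k] by auto
      then show ?thesis
        using Suc.prems by simp
    next
      case False
      then have "A k \<subset> A (Suc k)"
        using A_mono[of k] A_strict[of k] by auto
      then have "card (A k) < card (A (Suc k))"
        by (intro psubset_card_mono) auto
      then show ?thesis
        using Suc by simp
    qed
  qed simp
  then have "A (CARD('n)) = UNIV"
    by (intro card_seteq) auto
  then show ?thesis
    by (auto simp: A_def)
qed

section \<open>Hybrid time domains\<close>

text \<open>An intrinsic form of \<open>hybrid_time_domain\<close>. Every clause concerns finitely many points, so
  that it survives unions of chains.\<close>

definition time_domain_like :: "(real \<times> nat) set \<Rightarrow> bool" where
  "time_domain_like E \<longleftrightarrow> (0, 0) \<in> E \<and> (\<forall>s l. (s, l) \<in> E \<longrightarrow> 0 \<le> s) \<and>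
     (\<forall>a b s l. (a, l) \<in> E \<longrightarrow> (b, l) \<in> E \<longrightarrow> a \<le> s \<longrightarrow> s \<le> b \<longrightarrow> (s, l) \<in> E) \<and>
     (\<forall>a b k l. (a, k) \<in> E \<longrightarrow> (b, l) \<in> E \<longrightarrow> k < l \<longrightarrow> a \<le> b) \<and>
     (\<forall>s l. (s, Suc l) \<in> E \<longrightarrow> (\<exists>r. (r, l) \<in> E \<and> (r, Suc l) \<in> E))"

lemma hybrid_time_domain_imp_like:
  assumes "hybrid_time_domain E"
  shows "time_domain_like E"
proof -
  obtain t where t0: "t 0 = 0" and mono: "mono t" and
    E: "E = (\<Union>k. {t k..t (Suc k)} \<times> {k})
         \<or> (\<exists>K. E = (\<Union>k\<le>K. {t k..t (Suc k)} \<times> {k}))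
         \<or> (\<exists>K T. ereal (t K) < T \<and>
               E = (\<Union>k<K. {t k..t (Suc k)} \<times> {k}) \<union> {s. t K \<le> s \<and> ereal s < T} \<times> {K})"
    using assms unfolding hybrid_time_domain_def by blast
  have le: "t k \<le> t l" if "k \<le> l" for k l
    using mono that by (rule monoD)
  have nonneg: "0 \<le> t k" for k
    using le[of 0 k] t0 by simp
  have ord: "a \<le> b" if "a \<le> t (Suc k)" "k < l" "t l \<le> b" for a b k l
    using le[of "Suc k" l] that by simp
  from E show ?thesis
  proof (elim disjE exE conjE)
    assume E: "E = (\<Union>k. {t k..t (Suc k)} \<times> {k})"
    show ?thesis
      unfolding time_domain_like_def
    proof (intro conjI allI impI)
      show "(0, 0) \<in> E"
        using t0 le[of 0 1] by (auto simp: E)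
      show "0 \<le> s" if "(s, l) \<in> E" for s l
        using that nonneg[of l] by (auto simp: E)
      show "(s, l) \<in> E" if "(a, l) \<in> E" "(b, l) \<in> E" "a \<le> s" "s \<le> b" for a b s l
        using that by (auto simp: E)
      show "a \<le> b" if "(a, k) \<in> E" "(b, l) \<in> E" "k < l" for a b k l
        using that ord[of a k l b] by (auto simp: E)
      show "\<exists>r. (r, l) \<in> E \<and> (r, Suc l) \<in> E" if "(s, Suc l) \<in> E" for s l
        using that le[of l "Suc l"] le[of "Suc l" "Suc (Suc l)"]
        by (intro exI[of _ "t (Suc l)"]) (auto simp: E)
    qed
  next
    fix K assume E: "E = (\<Union>k\<le>K. {t k..t (Suc k)} \<times> {k})"
    show ?thesis
      unfolding time_domain_like_def
    proof (intro conjI allI impI)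
      show "(0, 0) \<in> E"
        using t0 le[of 0 1] by (auto simp: E)
      show "0 \<le> s" if "(s, l) \<in> E" for s l
        using that nonneg[of l] by (auto simp: E)
      show "(s, l) \<in> E" if "(a, l) \<in> E" "(b, l) \<in> E" "a \<le> s" "s \<le> b" for a b s l
        using that by (auto simp: E)
      show "a \<le> b" if "(a, k) \<in> E" "(b, l) \<in> E" "k < l" for a b k l
        using that ord[of a k l b] by (auto simp: E)
      show "\<exists>r. (r, l) \<in> E \<and> (r, Suc l) \<in> E" if "(s, Suc l) \<in> E" for s l
        using that le[of l "Suc l"] le[of "Suc l" "Suc (Suc l)"]
        by (intro exI[of _ "t (Suc l)"]) (auto simp: E)
    qed
  next
    fix K T assume T: "ereal (t K) < T"
      and E: "E = (\<Union>k<K. {t k..t (Suc k)} \<times> {k}) \<union> {s. t K \<le> s \<and> ereal s < T} \<times> {K}"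
    have T': "ereal s < T" if "s \<le> b" "ereal b < T" for s b
      using that by (meson ereal_less_eq(3) le_less_trans)
    show ?thesis
      unfolding time_domain_like_def
    proof (intro conjI allI impI)
      show "(0, 0) \<in> E"
        using t0 T le[of 0 1] by (cases K) (auto simp: E)
      show "0 \<le> s" if "(s, l) \<in> E" for s l
        using that nonneg[of l] by (auto simp: E)
      show "(s, l) \<in> E" if "(a, l) \<in> E" "(b, l) \<in> E" "a \<le> s" "s \<le> b" for a b s l
        using that T' by (auto simp: E)
      show "a \<le> b" if "(a, k) \<in> E" "(b, l) \<in> E" "k < l" for a b k l
        using that ord[of a k l b] by (auto simp: E)
      \<comment> \<open>If \<open>Suc l = K\<close>, the jump point \<open>t K\<close> belongs to
        the right-open level because that level is nonempty, \<open>ereal (t K) < T\<close>.\<close>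
      show "\<exists>r. (r, l) \<in> E \<and> (r, Suc l) \<in> E" if "(s, Suc l) \<in> E" for s l
        using that T le[of l "Suc l"] le[of "Suc l" "Suc (Suc l)"]
        by (intro exI[of _ "t (Suc l)"]) (auto simp: E less_Suc_eq_le le_less)
    qed
  qed
qed

text \<open>The switching instants are recovered as common points of consecutive levels, and the
  inhabited levels form an initial segment of the naturals. The three alternatives of the definition
  correspond to no last level, a last level with a greatest point, and a last level without
  one.\<close>

lemma like_imp_hybrid_time_domain:
  assumes "time_domain_like E"
  shows "hybrid_time_domain E"
proof -
  have zero: "(0, 0) \<in> E" and nonneg: "\<And>s l. (s, l) \<in> E \<Longrightarrow> 0 \<le> s"
    and conv: "\<And>a b s l. (a, l) \<in> E \<Longrightarrow> (b, l) \<in> E \<Longrightarrow> a \<le> s \<Longrightarrow> s \<le> b \<Longrightarrow> (s, l) \<in> E"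
    and ord: "\<And>a b k l. (a, k) \<in> E \<Longrightarrow> (b, l) \<in> E \<Longrightarrow> k < l \<Longrightarrow> a \<le> b"
    and pred: "\<And>s l. (s, Suc l) \<in> E \<Longrightarrow> \<exists>r. (r, l) \<in> E \<and> (r, Suc l) \<in> E"
    using assms unfolding time_domain_like_def by blast+
  define L where "L = {k. \<exists>s. (s, k) \<in> E}"
  have L_Suc: "k \<in> L" if "Suc k \<in> L" for k
    using that pred unfolding L_def by blast
  have L_down: "k \<in> L" if "l \<in> L" "k \<le> l" for k l
    using that(2,1) by (induction rule: inc_induct) (auto intro: L_Suc)
  define jump where "jump k = (SOME r. (r, k) \<in> E \<and> (r, Suc k) \<in> E)" for k
  have jump: "(jump k, k) \<in> E" "(jump k, Suc k) \<in> E" if "Suc k \<in> L" for k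
    using someI_ex[of "\<lambda>r. (r, k) \<in> E \<and> (r, Suc k) \<in> E"] pred that
    unfolding L_def jump_def by blast+
  \<comment> \<open>The parameter \<open>b\<close> fills the indices beyond the last level. It is
    the right end of a last level that has a greatest point; in the right-open case it only has to
    keep the sequence nondecreasing.\<close>
  define t where "t b k = (case k of 0 \<Rightarrow> 0 | Suc l \<Rightarrow> if k \<in> L then jump l else b)" for b k
  have t0: "t b 0 = 0" for b
    by (simp add: t_def)
  have t_in: "(t b k, k) \<in> E" if "k \<in> L" for b k
    using that zero jump by (cases k) (auto simp: t_def)
  have t_le: "t b k \<le> s" if "(s, k) \<in> E" for b k s
  proof -
    have "k \<in> L"
      using that by (auto simp: L_def)
    then show ?thesis
      using nonneg[OF that] ord[OF jump(1) that] by (cases k) (auto simp: t_def)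
  qed
  have t_SucL: "t b (Suc k) = jump k" if "Suc k \<in> L" for b k
    using that by (simp add: t_def)
  have t_notL: "t b (Suc k) = b" if "Suc k \<notin> L" for b k
    using that by (simp add: t_def)
  \<comment> \<open>A level with a successor contains its jump instant, and every point of it
    precedes the same instant on the next level. Hence it is closed on the right.\<close>
  have level_closed: "(s, k) \<in> E \<longleftrightarrow> t b k \<le> s \<and> s \<le> t b (Suc k)" if "Suc k \<in> L" for b k s
    unfolding t_SucL[OF that]
    using that by (meson L_Suc conv jump lessI ord t_in t_le)
  show ?thesis
  proof (cases "\<forall>k. k \<in> L")
    case True
    have "mono (t 0)"
    proof (rule incseq_SucI)
      fix k
      have "(t 0 k, k) \<in> E"
        using True t_in by blast
      then show "t 0 k \<le> t 0 (Suc k)"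
        using True level_closed[of k "t 0 k" 0] by simp
    qed
    moreover have "E = (\<Union>k. {t 0 k..t 0 (Suc k)} \<times> {k})"
      using True level_closed by auto
    ultimately show ?thesis
      using t0 unfolding hybrid_time_domain_def by blast
  next
    case False
    then obtain m where m: "m \<notin> L"
      by blast
    have "0 \<in> L"
      using zero by (auto simp: L_def)
    have "\<exists>K. K \<in> L \<and> Suc K \<notin> L"
    proof (rule ccontr)
      assume "\<not> ?thesis"
      then have "k \<in> L" for k
        using \<open>0 \<in> L\<close> by (induction k) auto
      then show False
        using m by blast
    qed
    then obtain K where K: "K \<in> L" "Suc K \<notin> L"
      by blast
    have L_eq: "k \<in> L \<longleftrightarrow> k \<le> K" for k
      using K L_down by (meson not_less_eq_eq)
    have mono: "mono (t b)" if b: "t b K \<le> b" for b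
    proof (rule incseq_SucI)
      fix k
      consider "k < K" | "k = K" | "K < k"
        by linarith
      then show "t b k \<le> t b (Suc k)"
      proof cases
        case 1
        then show ?thesis
          using level_closed[of k "t b k" b] t_in[of k b] L_eq by auto
      next
        case 2
        then show ?thesis
          using b t_notL[of k b] L_eq by simp
      next
        case 3
        then show ?thesis
          using L_eq by (cases k) (auto simp: t_def)
      qed
    qed
    have tK: "t b K = t 0 K" for b
      using K by (cases K) (auto simp: t_def)
    have E_split: "(s, k) \<in> E \<longleftrightarrow> k < K \<and> s \<in> {t b k..t b (Suc k)} \<or> k = K \<and> (s, K) \<in> E"
      for s k b
    proof (cases "k < K")
      case True
      then show ?thesis
        using level_closed[of k s b] L_eq by auto
    next
      case False
      have "k \<le> K" if "(s, k) \<in> E"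
        using that L_eq[of k] by (auto simp: L_def)
      then show ?thesis
        using False by auto
    qed
    show ?thesis
    proof (cases "\<exists>b. (b, K) \<in> E \<and> (\<forall>s. (s, K) \<in> E \<longrightarrow> s \<le> b)")
      case True
      then obtain b where b: "(b, K) \<in> E" "\<And>s. (s, K) \<in> E \<Longrightarrow> s \<le> b"
        by blast
      have "(s, K) \<in> E \<longleftrightarrow> s \<in> {t b K..t b (Suc K)}" for s
        unfolding t_notL[OF K(2)] atLeastAtMost_iff using K(1) by (meson b t_le t_in conv)
      then have "(s, k) \<in> E \<longleftrightarrow> k \<le> K \<and> s \<in> {t b k..t b (Suc k)}" for s k
        using E_split[of s k b] by (metis le_less)
      then have "E = (\<Union>k\<le>K. {t b k..t b (Suc k)} \<times> {k})"
        by auto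
      moreover have "mono (t b)"
        by (intro mono t_le b)
      ultimately show ?thesis
        using t0 unfolding hybrid_time_domain_def by blast
    next
      case False
      define b where "b = t 0 K"
      \<comment> \<open>The supremum is taken in the extended reals, so an unbounded level gets an
        infinite right end. As the level has no greatest point, all its points lie strictly below
        \<open>T\<close>.\<close>
      define T where "T = (SUP s\<in>{s. (s, K) \<in> E}. ereal s)"
      have T: "ereal s < T \<longleftrightarrow> (\<exists>r. (r, K) \<in> E \<and> s < r)" for s
        unfolding T_def by (auto simp: less_SUP_iff)
      have level: "(s, K) \<in> E \<longleftrightarrow> t b K \<le> s \<and> ereal s < T" for s
      proof
        show "t b K \<le> s \<and> ereal s < T" if "(s, K) \<in> E"
          using that False t_le unfolding T by (meson not_le)
        show "(s, K) \<in> E" if "t b K \<le> s \<and> ereal s < T"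
          using that conv[OF t_in[OF K(1)]] unfolding T by (meson less_imp_le)
      qed
      have "E = (\<Union>k<K. {t b k..t b (Suc k)} \<times> {k}) \<union> {s. t b K \<le> s \<and> ereal s < T} \<times> {K}"
      proof (rule set_eqI, clarify)
        fix s k
        show "(s, k) \<in> E \<longleftrightarrow> (s, k) \<in>
            (\<Union>k<K. {t b k..t b (Suc k)} \<times> {k}) \<union> {s. t b K \<le> s \<and> ereal s < T} \<times> {K}"
          using E_split[of s k b] level[of s] by auto
      qed
      moreover have "mono (t b)"
        using tK[of b] by (intro mono) (simp add: b_def)
      moreover have "ereal (t b K) < T"
        using level[of "t b K"] t_in[OF K(1)] by simp
      ultimately show ?thesis
        using t0 unfolding hybrid_time_domain_def by blast
    qed
  qed
qed

lemma hybrid_time_domain_iff: "hybrid_time_domain E \<longleftrightarrow> time_domain_like E"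
  using hybrid_time_domain_imp_like like_imp_hybrid_time_domain by blast

context
  fixes E :: "(real \<times> nat) set"
  assumes E: "hybrid_time_domain E"
begin

lemma time_domain_zero: "(0, 0) \<in> E"
  and time_domain_nonneg: "(s, l) \<in> E \<Longrightarrow> 0 \<le> s"
  and time_domain_convex: "(a, l) \<in> E \<Longrightarrow> (b, l) \<in> E \<Longrightarrow> a \<le> s \<Longrightarrow> s \<le> b \<Longrightarrow> (s, l) \<in> E"
  and time_domain_order: "(a, k) \<in> E \<Longrightarrow> (b, l) \<in> E \<Longrightarrow> k < l \<Longrightarrow> a \<le> b"
  and time_domain_pred: "(s, Suc l) \<in> E \<Longrightarrow> \<exists>r. (r, l) \<in> E \<and> (r, Suc l) \<in> E"
  using E unfolding hybrid_time_domain_iff time_domain_like_def by blast+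

lemma time_domain_jump_unique:
  assumes "(r, l) \<in> E" "(r, Suc l) \<in> E" "(s, l) \<in> E" "(s, Suc l) \<in> E"
  shows "r = s"
  using time_domain_order[OF assms(1,4)] time_domain_order[OF assms(3,2)] by simp

lemma time_domain_jump_below:
  assumes "(t, k) \<in> E" "l < k"
  shows "\<exists>r. (r, l) \<in> E \<and> (r, Suc l) \<in> E"
  using assms
proof (induction k arbitrary: t)
  case (Suc k)
  then show ?case
    using time_domain_pred[OF Suc.prems(1)] by (metis less_Suc_eq)
qed simp

text \<open>Time does not decrease along the jump counter, so the order by \<open>s + l\<close> is
  the componentwise one on a time domain.\<close>

lemma time_domain_before:
  assumes "(t, k) \<in> E" "(s, l) \<in> E" "s + real l \<le> t + real k"
  shows "s \<le> t" "l \<le> k"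
proof -
  show "l \<le> k"
    using time_domain_order[OF assms(1,2)] assms(3) by (cases "k < l") auto
  then show "s \<le> t"
    using time_domain_order[OF assms(2,1)] assms(3) by (cases "k = l") auto
qed

text \<open>A level starts at \<open>0\<close> or at the jump leading into it. Both belong to
  \<open>E\<close>, so no larger time domain can prepend points to an inhabited level.\<close>

lemma time_domain_level_start:
  assumes "(t, l) \<in> E"
  shows "\<exists>a. (a, l) \<in> E \<and> (\<forall>E' s. hybrid_time_domain E' \<longrightarrow> E \<subseteq> E' \<longrightarrow> (s, l) \<in> E' \<longrightarrow> a \<le> s)"
proof (cases l)
  case 0
  then show ?thesis
    using time_domain_zero Submission.time_domain_nonneg by blast
next
  case (Suc m)
  then obtain r where r: "(r, m) \<in> E" "(r, l) \<in> E"
    using time_domain_pred assms by blast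
  have "r \<le> s" if "hybrid_time_domain E'" "E \<subseteq> E'" "(s, l) \<in> E'" for E' s
    using that r Suc unfolding hybrid_time_domain_iff time_domain_like_def
    by (meson lessI subsetD)
  then show ?thesis
    using r by blast
qed

text \<open>Levels below \<open>k\<close> end at their jump and level \<open>k\<close> is cut off at
  \<open>t\<close>, so even right-open levels contribute only a compact part. Local essential
  boundedness can then be used to make the norm finite.\<close>

lemma time_domain_before_compact:
  assumes "(t, k) \<in> E"
  shows "\<exists>a b. {s. (s, l) \<in> E \<and> s + real l \<le> t + real k} \<subseteq> {a..b} \<and> {a..b} \<times> {l} \<subseteq> E"
proof (cases "\<exists>s. (s, l) \<in> E \<and> s + real l \<le> t + real k")
  case True
  then obtain s where s: "(s, l) \<in> E" "s + real l \<le> t + real k"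
    by blast
  obtain a where a: "(a, l) \<in> E" "\<And>s. (s, l) \<in> E \<Longrightarrow> a \<le> s"
    using time_domain_level_start[OF s(1)] E by blast
  have "\<exists>b. (b, l) \<in> E \<and> (\<forall>s. (s, l) \<in> E \<longrightarrow> s + real l \<le> t + real k \<longrightarrow> s \<le> b)"
  proof (cases "l = k")
    case True
    then show ?thesis
      using assms by auto
  next
    case False
    then have "l < k"
      using time_domain_before(2)[OF assms s] by simp
    then show ?thesis
      using time_domain_jump_below[OF assms] time_domain_order by blast
  qed
  then obtain b where b: "(b, l) \<in> E" "\<And>s. (s, l) \<in> E \<Longrightarrow> s + real l \<le> t + real k \<Longrightarrow> s \<le> b"
    by blast
  have "{a..b} \<times> {l} \<subseteq> E"
    using time_domain_convex[OF a(1) b(1)] by auto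
  then show ?thesis
    using a b by (intro exI[of _ a] exI[of _ b]) auto
next
  case False
  then show ?thesis
    by (intro exI[of _ 1] exI[of _ 0]) auto
qed

text \<open>On a level below \<open>k\<close> the jump out of it lies in \<open>E\<close> and bounds
  the level from above in every larger time domain; on level \<open>k\<close> the bound is
  \<open>t\<close>. Since the start of the level is fixed as well, convexity of \<open>E\<close>
  leaves no room for new points.\<close>

lemma time_domain_initial_segment:
  assumes E': "hybrid_time_domain E'" "E \<subseteq> E'"
    and t: "(t, k) \<in> E" and s: "(s, l) \<in> E'" "s + real l \<le> t + real k"
  shows "(s, l) \<in> E"
proof -
  have le: "s \<le> t" "l \<le> k"
    using time_domain_before t s E' by (metis Submission.time_domain_before subsetD)+
  have "\<exists>b. (b, l) \<in> E \<and> s \<le> b"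
  proof (cases "l = k")
    case True
    then show ?thesis
      using t le by auto
  next
    case False
    then obtain r where r: "(r, l) \<in> E" "(r, Suc l) \<in> E"
      using time_domain_jump_below[OF t, of l] le by auto
    then show ?thesis
      using Submission.time_domain_order[OF E'(1) s(1)] E'(2) by blast
  qed
  then obtain b where b: "(b, l) \<in> E" "s \<le> b"
    by blast
  then show ?thesis
    using time_domain_level_start[OF b(1)] E' s(1) time_domain_convex b by blast
qed

end

section \<open>Real intervals as countable unions of compact intervals\<close>

text \<open>Passing from compact intervals to a whole level may cost only countably many null sets,
  although a chain of domains need not be countable. Rational end points suffice together with the
  least and the greatest element of \<open>I\<close>, if they exist.\<close>

lemma interval_countable_cover:
  fixes I :: "real set"
  assumes I: "is_interval I"
  obtains C where "countable C" "C \<subseteq> I \<times> I" "I = (\<Union>(a, b)\<in>C. {a..b})"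
proof
  have conv: "s \<in> I" if "a \<in> I" "b \<in> I" "a \<le> s" "s \<le> b" for a b s
    using I that unfolding is_interval_1 by blast
  define lo where "lo = {a \<in> I. \<forall>s\<in>I. a \<le> s}"
  define hi where "hi = {b \<in> I. \<forall>s\<in>I. s \<le> b}"
  define Q where "Q = I \<inter> \<rat> \<union> lo \<union> hi"
  have "lo \<subseteq> {a}" if "a \<in> lo" for a
    using that by (auto simp: lo_def intro: antisym)
  then have "countable lo"
    by (metis countable_empty countable_insert countable_subset ex_in_conv)
  moreover have "hi \<subseteq> {b}" if "b \<in> hi" for b
    using that by (auto simp: hi_def intro: antisym)
  then have "countable hi"
    by (metis countable_empty countable_insert countable_subset ex_in_conv)
  ultimately show "countable (Q \<times> Q)"
    using countable_rat by (auto simp: Q_def intro!: countable_SIGMA countable_Int2)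
  show QI: "Q \<times> Q \<subseteq> I \<times> I"
    by (auto simp: Q_def lo_def hi_def)
  have "\<exists>a\<in>Q. a \<le> s" if s: "s \<in> I" for s
  proof (cases "s \<in> lo")
    case False
    then obtain r where "r \<in> I" "r < s"
      using s by (auto simp: lo_def not_le)
    moreover then obtain q where "q \<in> \<rat>" "r < q" "q < s"
      using Rats_dense_in_real by blast
    ultimately show ?thesis
      using conv[of r s q] s by (auto simp: Q_def intro!: bexI[of _ q])
  qed (auto simp: Q_def)
  moreover have "\<exists>b\<in>Q. s \<le> b" if s: "s \<in> I" for s
  proof (cases "s \<in> hi")
    case False
    then obtain r where "r \<in> I" "s < r"
      using s by (auto simp: hi_def not_le)
    moreover then obtain q where "q \<in> \<rat>" "s < q" "q < r"
      using Rats_dense_in_real by blast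
    ultimately show ?thesis
      using conv[of s r q] s by (auto simp: Q_def intro!: bexI[of _ q])
  qed (auto simp: Q_def)
  ultimately have "I \<subseteq> (\<Union>(a, b)\<in>Q \<times> Q. {a..b})"
    by fastforce
  moreover have "{a..b} \<subseteq> I" if "a \<in> Q" "b \<in> Q" for a b
    using that QI conv[of a b] by auto
  ultimately show "I = (\<Union>(a, b)\<in>Q \<times> Q. {a..b})"
    by auto
qed

lemma interval_lebesgue_sets:
  fixes I :: "real set"
  assumes "is_interval I"
  shows "I \<in> sets lebesgue"
proof -
  obtain C where "countable C" "I = (\<Union>(a, b)\<in>C. {a..b})"
    using interval_countable_cover[OF assms] by metis
  then show ?thesis
    by (auto intro!: sets.countable_UN')
qed

lemma measurable_lebesgue_on_interval:
  fixes I :: "real set" and f :: "real \<Rightarrow> 'a::topological_space"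
  assumes I: "is_interval I"
    and meas: "\<And>a b. a \<in> I \<Longrightarrow> b \<in> I \<Longrightarrow> f \<in> borel_measurable (lebesgue_on {a..b})"
  shows "f \<in> borel_measurable (lebesgue_on I)"
proof -
  obtain C where C: "countable C" "C \<subseteq> I \<times> I" "I = (\<Union>(a, b)\<in>C. {a..b})"
    using interval_countable_cover[OF I] by metis
  have I_sets: "I \<in> sets lebesgue"
    by (rule interval_lebesgue_sets[OF I])
  show ?thesis
  proof (rule measurable_piecewise_restrict)
    show "countable ((\<lambda>(a, b). {a..b}) ` C)"
      using C by simp
    show "space (lebesgue_on I) \<subseteq> \<Union> ((\<lambda>(a, b). {a..b}) ` C)"
      using C(3) by simp
    fix J assume "J \<in> (\<lambda>(a, b). {a..b}) ` C"
    then obtain a b where ab: "a \<in> I" "b \<in> I" "J = {a..b}"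
      using C(2) by auto
    then have "J \<subseteq> I"
      using I unfolding is_interval_1 by (meson atLeastAtMost_iff subsetI)
    then show "J \<inter> space (lebesgue_on I) \<in> sets (lebesgue_on I)"
      using ab I_sets by (auto simp: sets_restrict_space_iff Int_absorb2)
    have "restrict_space (lebesgue_on I) J = lebesgue_on J"
      using \<open>J \<subseteq> I\<close> I_sets ab by (subst restrict_restrict_space) (auto simp: Int_absorb1)
    then show "f \<in> borel_measurable (restrict_space (lebesgue_on I) J)"
      using meas ab by simp
  qed
qed

text \<open>The premise is restricted to interior points because only there does a derivative within
  a smaller level determine the derivative within a larger one. The end points of the countably many
  intervals form a null set.\<close>

lemma AE_lebesgue_interval:
  fixes I :: "real set"
  assumes I: "is_interval I"
    and ae: "\<And>a b. a \<in> I \<Longrightarrow> b \<in> I \<Longrightarrow> AE t in lebesgue. a < t \<longrightarrow> t < b \<longrightarrow> P t"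
  shows "AE t in lebesgue. t \<in> I \<longrightarrow> P t"
proof -
  obtain C where C: "countable C" "C \<subseteq> I \<times> I" "I = (\<Union>(a, b)\<in>C. {a..b})"
    using interval_countable_cover[OF I] by metis
  have "AE t in lebesgue. \<forall>p\<in>C. fst p < t \<longrightarrow> t < snd p \<longrightarrow> P t"
  proof (subst AE_ball_countable[OF C(1)], intro ballI)
    fix p assume "p \<in> C"
    then show "AE t in lebesgue. fst p < t \<longrightarrow> t < snd p \<longrightarrow> P t"
      using C(2) by (intro ae) auto
  qed
  moreover have "fst ` C \<union> snd ` C \<in> null_sets lborel"
    using C by (intro countable_imp_null_set_lborel) auto
  then have "AE t in lebesgue. t \<notin> fst ` C \<union> snd ` C"
    by (intro AE_not_in) (auto simp: null_sets_completionI)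
  ultimately show ?thesis
  proof eventually_elim
    case (elim t)
    show ?case
    proof
      assume "t \<in> I"
      then obtain p where p: "p \<in> C" "fst p \<le> t" "t \<le> snd p"
        using C(3) by auto
      then have "fst p \<noteq> t" "t \<noteq> snd p"
        using elim(2) by auto
      then show "P t"
        using p elim(1) by auto
    qed
  qed
qed

section \<open>Unions of chains of partial maps\<close>

text \<open>The union of the graphs. Members of a chain agree wherever both are defined, so the
  choice does not affect the value.\<close>

definition chain_lub :: "('a \<rightharpoonup> 'b) set \<Rightarrow> 'a \<rightharpoonup> 'b" where
  "chain_lub F z = (if \<exists>x\<in>F. z \<in> dom x then (SOME x. x \<in> F \<and> z \<in> dom x) z else None)"

lemma chain_lub_upper:
  assumes chain: "\<forall>x\<in>F. \<forall>y\<in>F. x \<subseteq>\<^sub>m y \<or> y \<subseteq>\<^sub>m x" and x: "x \<in> F"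
  shows "x \<subseteq>\<^sub>m chain_lub F"
  unfolding map_le_def
proof
  fix z assume z: "z \<in> dom x"
  define y where "y = (SOME y. y \<in> F \<and> z \<in> dom y)"
  have "y \<in> F \<and> z \<in> dom y"
    unfolding y_def using someI[of "\<lambda>y. y \<in> F \<and> z \<in> dom y"] x z by blast
  moreover have "chain_lub F z = y z"
    using x z by (auto simp: chain_lub_def y_def)
  ultimately show "x z = chain_lub F z"
    using chain x z unfolding map_le_def by metis
qed

lemma dom_chain_lub:
  assumes chain: "\<forall>x\<in>F. \<forall>y\<in>F. x \<subseteq>\<^sub>m y \<or> y \<subseteq>\<^sub>m x"
  shows "dom (chain_lub F) = (\<Union>x\<in>F. dom x)"
proof
  show "(\<Union>x\<in>F. dom x) \<subseteq> dom (chain_lub F)"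
    using map_le_implies_dom_le[OF chain_lub_upper[OF chain]] by blast
  show "dom (chain_lub F) \<subseteq> (\<Union>x\<in>F. dom x)"
    by (auto simp: chain_lub_def split: if_splits)
qed

lemma is_interval_level:
  assumes "is_hybrid_signal x"
  shows "is_interval (level x k)"
  using time_domain_convex assms unfolding is_interval_1 level_def is_hybrid_signal_def by blast

lemma hybrid_inputD:
  assumes "hybrid_input u"
  shows "is_hybrid_signal u" "(\<lambda>t. val u t k) \<in> borel_measurable (lebesgue_on (level u k))"
    "compact J \<Longrightarrow> J \<subseteq> level u k \<Longrightarrow> \<exists>B. AE t in lebesgue_on J. norm (val u t k) \<le> B"
  using assms by (auto simp: hybrid_input_def)

lemma hybrid_arcD:
  assumes "hybrid_arc x"
  shows "is_hybrid_signal x" "{a..b} \<subseteq> level x k \<Longrightarrow> abs_cont_on a b (\<lambda>t. val x t k)"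
  using assms by (auto simp: hybrid_arc_def)

lemma abs_cont_on_cong:
  assumes "\<And>t. t \<in> {a..b} \<Longrightarrow> f t = g t" "abs_cont_on a b f"
  shows "abs_cont_on a b g"
  unfolding abs_cont_on_def
proof (intro allI impI)
  fix e :: real assume "0 < e"
  then obtain d where d: "d > 0" and f: "\<And>\<D>. \<D> division_of \<Union>\<D> \<Longrightarrow> \<Union>\<D> \<subseteq> {a..b} \<Longrightarrow>
      (\<Sum>I\<in>\<D>. measure lborel I) < d \<Longrightarrow> (\<Sum>I\<in>\<D>. norm (f (Sup I) - f (Inf I))) < e"
    using assms(2) unfolding abs_cont_on_def by meson
  have "(\<Sum>I\<in>\<D>. norm (g (Sup I) - g (Inf I))) < e"
    if D: "\<D> division_of \<Union>\<D>" "\<Union>\<D> \<subseteq> {a..b}" "(\<Sum>I\<in>\<D>. measure lborel I) < d" for \<D>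
  proof -
    have "g (Sup I) = f (Sup I) \<and> g (Inf I) = f (Inf I)" if I: "I \<in> \<D>" for I
    proof -
      obtain p q where pq: "I = {p..q}" "I \<noteq> {}"
        using division_ofD(3,4)[OF D(1) I] by auto
      then have "p \<in> \<Union>\<D>" "q \<in> \<Union>\<D>"
        using I by auto
      then have "p \<in> {a..b}" "q \<in> {a..b}"
        using D(2) by blast+
      then show ?thesis
        using pq assms(1) by simp
    qed
    then have "(\<Sum>I\<in>\<D>. norm (g (Sup I) - g (Inf I))) = (\<Sum>I\<in>\<D>. norm (f (Sup I) - f (Inf I)))"
      by (intro sum.cong) auto
    then show ?thesis
      using f D by simp
  qed
  then show "\<exists>d>0. \<forall>\<D>. \<D> division_of \<Union>\<D> \<and> \<Union>\<D> \<subseteq> {a..b} \<and> (\<Sum>I\<in>\<D>. measure lborel I) < d \<longrightarrow>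
      (\<Sum>I\<in>\<D>. norm (g (Sup I) - g (Inf I))) < e"
    using d by blast
qed

lemma abs_cont_on_trivial:
  assumes "b \<le> a"
  shows "abs_cont_on a b f"
  unfolding abs_cont_on_def
proof (intro allI impI exI[of _ 1] conjI)
  fix e :: real and \<D> assume e: "0 < e"
    and D: "\<D> division_of \<Union>\<D> \<and> \<Union>\<D> \<subseteq> {a..b} \<and> (\<Sum>I\<in>\<D>. measure lborel I) < 1"
  have "f (Sup I) = f (Inf I)" if I: "I \<in> \<D>" for I
  proof -
    have D': "\<D> division_of \<Union>\<D>"
      using D by blast
    obtain p q where pq: "I = {p..q}" "I \<noteq> {}"
      using division_ofD(3,4)[OF D' I] by auto
    then have "p \<in> \<Union>\<D>" "q \<in> \<Union>\<D>"
      using I by auto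
    then have "p \<in> {a..b}" "q \<in> {a..b}"
      using D by blast+
    then have "p = q"
      using assms by simp
    then show ?thesis
      using pq by simp
  qed
  then show "(\<Sum>I\<in>\<D>. norm (f (Sup I) - f (Inf I))) < e"
    using e by simp
qed simp

lemma solution_pairD:
  assumes "solution_pair S x v"
  shows "hybrid_arc x" "ran x \<subseteq> state_space S" "hybrid_input v" "ran v \<subseteq> input_space S"
    "dom v = dom x" "(val x 0 0, val v 0 0) \<in> flow_set S \<union> jump_set S"
    "AE t in lebesgue. (t, k) \<in> dom x \<longrightarrow>
        (val x t k, val v t k) \<in> flow_set S \<and>
        ((\<lambda>\<tau>. val x \<tau> k) has_vector_derivative flow_map S (val x t k, val v t k))
           (at t within level x k)"
    "(t, k) \<in> dom x \<Longrightarrow> (t, Suc k) \<in> dom x \<Longrightarrow> (val x t k, val v t k) \<in> jump_set S"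
    "(t, k) \<in> dom x \<Longrightarrow> (t, Suc k) \<in> dom x \<Longrightarrow> val x t (Suc k) = jump_map S (val x t k, val v t k)"
  using assms unfolding solution_pair_def by blast+

lemma solution_pair_time_domain:
  assumes "solution_pair S x v"
  shows "hybrid_time_domain (dom x)"
  using hybrid_arcD(1)[OF solution_pairD(1)[OF assms]] by (simp add: is_hybrid_signal_def)

section \<open>Maximal extensions of solution pairs\<close>

text \<open>Each condition on a solution pair concerns at most two points, a compact subset of a
  level, or almost every point of a level. The first two kinds can be checked inside one member of
  the chain; the third, like measurability, is assembled from countably many compact
  intervals.\<close>

lemma solution_pair_chain_lub:
  fixes C :: "('x::euclidean_space hybrid_signal \<times> 'v::euclidean_space hybrid_signal) set"
  assumes nonempty: "C \<noteq> {}" and sol: "\<And>p. p \<in> C \<Longrightarrow> solution_pair S (fst p) (snd p)"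
    and chain: "\<And>p q. p \<in> C \<Longrightarrow> q \<in> C \<Longrightarrow>
      fst p \<subseteq>\<^sub>m fst q \<and> snd p \<subseteq>\<^sub>m snd q \<or> fst q \<subseteq>\<^sub>m fst p \<and> snd q \<subseteq>\<^sub>m snd p"
  shows "solution_pair S (chain_lub (fst ` C)) (chain_lub (snd ` C))"
proof -
  define X where "X = chain_lub (fst ` C)"
  define V where "V = chain_lub (snd ` C)"
  have chain_fst: "\<forall>x\<in>fst ` C. \<forall>y\<in>fst ` C. x \<subseteq>\<^sub>m y \<or> y \<subseteq>\<^sub>m x"
    using chain by blast
  have chain_snd: "\<forall>x\<in>snd ` C. \<forall>y\<in>snd ` C. x \<subseteq>\<^sub>m y \<or> y \<subseteq>\<^sub>m x"
    using chain by blast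
  have dom_eq: "dom (snd p) = dom (fst p)" if "p \<in> C" for p
    using solution_pairD(5)[OF sol[OF that]] .
  have dom_X: "dom X = (\<Union>p\<in>C. dom (fst p))"
    unfolding X_def using dom_chain_lub[OF chain_fst] by auto
  have dom_V: "dom V = dom X"
    unfolding V_def dom_X using dom_chain_lub[OF chain_snd] dom_eq by auto
  have agree: "X z = fst p z" "V z = snd p z" if "p \<in> C" "z \<in> dom (fst p)" for p z
    using that chain_lub_upper[OF chain_fst, of "fst p"] chain_lub_upper[OF chain_snd, of "snd p"]
      dom_eq[OF that(1)]
    by (auto simp: X_def V_def map_le_def)
  \<comment> \<open>Two members of a chain are comparable, so two points of the union lie in one
    member. By convexity that member also contains the interval between points of the same level,
    which yields \<open>piece\<close>.\<close>
  have member2: "\<exists>p\<in>C. z \<in> dom (fst p) \<and> z' \<in> dom (fst p)" if z: "z \<in> dom X" "z' \<in> dom X" for z z'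
  proof -
    obtain p q where "p \<in> C" "z \<in> dom (fst p)" "q \<in> C" "z' \<in> dom (fst q)"
      using z dom_X by blast
    then show ?thesis
      using chain[of p q] map_le_implies_dom_le by blast
  qed
  have htd: "hybrid_time_domain (dom (fst p))" if "p \<in> C" for p
    using solution_pair_time_domain[OF sol[OF that]] .
  have dom_X_htd: "hybrid_time_domain (dom X)"
    unfolding hybrid_time_domain_iff time_domain_like_def
  proof (intro conjI allI impI)
    show "(0, 0) \<in> dom X"
      using nonempty htd time_domain_zero unfolding dom_X by blast
    show "0 \<le> s" if "(s, l) \<in> dom X" for s l
      using that htd time_domain_nonneg unfolding dom_X by blast
    show "(s, l) \<in> dom X" if ab: "(a, l) \<in> dom X" "(b, l) \<in> dom X" "a \<le> s" "s \<le> b" for a b s l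
    proof -
      obtain p where p: "p \<in> C" "(a, l) \<in> dom (fst p)" "(b, l) \<in> dom (fst p)"
        using member2[OF ab(1,2)] by blast
      have "(s, l) \<in> dom (fst p)"
        by (rule time_domain_convex[OF htd[OF p(1)] p(2,3) ab(3,4)])
      then show ?thesis
        unfolding dom_X using p(1) by (rule UN_I[rotated])
    qed
    show "a \<le> b" if "(a, k) \<in> dom X" "(b, l) \<in> dom X" "k < l" for a b k l
      using member2[OF that(1,2)] time_domain_order[OF htd _ _ that(3)] by metis
    show "\<exists>r. (r, l) \<in> dom X \<and> (r, Suc l) \<in> dom X" if s: "(s, Suc l) \<in> dom X" for s l
    proof -
      obtain p where p: "p \<in> C" "(s, Suc l) \<in> dom (fst p)"
        using s unfolding dom_X by blast
      show ?thesis
        using time_domain_pred[OF htd[OF p(1)] p(2)] p(1) unfolding dom_X by blast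
    qed
  qed
  then have signals: "is_hybrid_signal X" "is_hybrid_signal V"
    by (simp_all add: is_hybrid_signal_def dom_V)
  have level_V: "level V k = level X k" for k
    by (simp add: level_def dom_V)
  have piece: "\<exists>p\<in>C. {a..b} \<subseteq> level (fst p) k \<and>
      (\<forall>t\<in>{a..b}. val X t k = val (fst p) t k \<and> val V t k = val (snd p) t k)"
    if ab: "a \<in> level X k" "b \<in> level X k" for a b k
  proof -
    obtain p where p: "p \<in> C" "(a, k) \<in> dom (fst p)" "(b, k) \<in> dom (fst p)"
      using member2 ab unfolding level_def by blast
    have sub: "{a..b} \<subseteq> level (fst p) k"
      unfolding level_def by (intro subsetI CollectI time_domain_convex[OF htd[OF p(1)] p(2,3)]) auto
    have "val X t k = val (fst p) t k \<and> val V t k = val (snd p) t k" if "t \<in> {a..b}" for t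
    proof -
      have "(t, k) \<in> dom (fst p)"
        using sub that unfolding level_def by blast
      then show ?thesis
        using agree[OF p(1)] by simp
    qed
    then show ?thesis
      using sub p(1) by blast
  qed
  have "hybrid_arc X"
    unfolding hybrid_arc_def
  proof (intro conjI allI impI signals)
    fix k a b assume ab: "{a..b} \<subseteq> level X k"
    show "abs_cont_on a b (\<lambda>t. val X t k)"
    proof (cases "a \<le> b")
      case True
      then obtain p where p: "p \<in> C" "{a..b} \<subseteq> level (fst p) k"
          "\<And>t. t \<in> {a..b} \<Longrightarrow> val X t k = val (fst p) t k"
        using piece[of a k b] ab by (metis atLeastAtMost_iff order_refl subsetD)
      have "abs_cont_on a b (\<lambda>t. val (fst p) t k)"
        using hybrid_arcD(2)[OF solution_pairD(1)[OF sol[OF p(1)]] p(2)] .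
      then show ?thesis
        by (rule abs_cont_on_cong[rotated]) (simp add: p(3))
    next
      case False
      then show ?thesis
        by (intro abs_cont_on_trivial) simp
    qed
  qed
  moreover have "hybrid_input V"
    unfolding hybrid_input_def
  proof (intro conjI allI impI signals)
    fix k
    show "(\<lambda>t. val V t k) \<in> borel_measurable (lebesgue_on (level V k))"
    proof (rule measurable_lebesgue_on_interval)
      show "is_interval (level V k)"
        by (rule is_interval_level[OF signals(2)])
      fix a b assume "a \<in> level V k" "b \<in> level V k"
      then obtain p where p: "p \<in> C" "{a..b} \<subseteq> level (fst p) k"
          "\<And>t. t \<in> {a..b} \<Longrightarrow> val V t k = val (snd p) t k"
        using piece[of a k b] unfolding level_V by blast
      then have "{a..b} \<subseteq> level (snd p) k"
        using dom_eq[OF p(1)] by (simp add: level_def)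
      moreover have "(\<lambda>t. val (snd p) t k) \<in> borel_measurable (lebesgue_on (level (snd p) k))"
        using hybrid_inputD(2)[OF solution_pairD(3)[OF sol[OF p(1)]]] .
      ultimately have "(\<lambda>t. val (snd p) t k) \<in> borel_measurable (lebesgue_on {a..b})"
        using measurable_restrict_mono by blast
      then show "(\<lambda>t. val V t k) \<in> borel_measurable (lebesgue_on {a..b})"
        using p(3) by (subst measurable_cong[where g = "\<lambda>t. val (snd p) t k"]) auto
    qed
    fix J assume J: "compact J \<and> J \<subseteq> level V k"
    show "\<exists>B. AE t in lebesgue_on J. norm (val V t k) \<le> B"
    proof (cases "J = {}")
      case True
      then show ?thesis
        by (auto simp: AE_restrict_space_iff)
    next
      case False
      obtain a where a: "a \<in> J" "\<And>t. t \<in> J \<Longrightarrow> a \<le> t"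
        using compact_attains_inf[of J] J False by metis
      obtain b where b: "b \<in> J" "\<And>t. t \<in> J \<Longrightarrow> t \<le> b"
        using compact_attains_sup[of J] J False by metis
      have ab: "a \<in> J" "b \<in> J" "J \<subseteq> {a..b}"
        using a b by auto
      then obtain p where p: "p \<in> C" "{a..b} \<subseteq> level (fst p) k"
          "\<And>t. t \<in> {a..b} \<Longrightarrow> val V t k = val (snd p) t k"
        using piece[of a k b] J unfolding level_V by blast
      then have "J \<subseteq> level (snd p) k"
        using dom_eq[OF p(1)] ab(3) p(2) unfolding level_def by auto
      then obtain B where B: "AE t in lebesgue_on J. norm (val (snd p) t k) \<le> B"
        using hybrid_inputD(3)[OF solution_pairD(3)[OF sol[OF p(1)]], of J k] J by blast
      have "AE t in lebesgue_on J. t \<in> J"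
        by (rule AE_I2) simp
      then have "AE t in lebesgue_on J. norm (val V t k) \<le> B"
        using B by eventually_elim (use p(3) ab in auto)
      then show ?thesis
        by blast
    qed
  qed
  moreover have "ran X \<subseteq> state_space S" "ran V \<subseteq> input_space S"
  proof -
    have "y \<in> state_space S" if y: "X z = Some y" for z y
    proof -
      obtain p where p: "p \<in> C" "z \<in> dom (fst p)"
        using domI[of X, OF y] unfolding dom_X by blast
      then show ?thesis
        using agree(1)[OF p] y solution_pairD(2)[OF sol[OF p(1)]] by (metis ranI subsetD)
    qed
    then show "ran X \<subseteq> state_space S"
      by (auto simp: ran_def)
    have "y \<in> input_space S" if y: "V z = Some y" for z y
    proof -
      obtain p where p: "p \<in> C" "z \<in> dom (fst p)"
        using domI[of V, OF y] unfolding dom_V dom_X by blast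
      then show ?thesis
        using agree(2)[OF p] y solution_pairD(4)[OF sol[OF p(1)]] by (metis ranI subsetD)
    qed
    then show "ran V \<subseteq> input_space S"
      by (auto simp: ran_def)
  qed
  moreover have "(val X 0 0, val V 0 0) \<in> flow_set S \<union> jump_set S"
  proof -
    obtain p where p: "p \<in> C"
      using nonempty by blast
    then show ?thesis
      using agree[OF p time_domain_zero[OF htd[OF p]]] solution_pairD(6)[OF sol[OF p]] by simp
  qed
  moreover have "AE t in lebesgue. (t, k) \<in> dom X \<longrightarrow>
        (val X t k, val V t k) \<in> flow_set S \<and>
        ((\<lambda>\<tau>. val X \<tau> k) has_vector_derivative flow_map S (val X t k, val V t k))
           (at t within level X k)" (is "AE t in lebesgue. (t, k) \<in> dom X \<longrightarrow> ?flow t") for k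
  proof -
    have "AE t in lebesgue. t \<in> level X k \<longrightarrow> ?flow t"
    proof (rule AE_lebesgue_interval)
      show "is_interval (level X k)"
        by (rule is_interval_level[OF signals(1)])
      fix a b assume "a \<in> level X k" "b \<in> level X k"
      then obtain p where p: "p \<in> C" "{a..b} \<subseteq> level (fst p) k"
          "\<And>t. t \<in> {a..b} \<Longrightarrow> val X t k = val (fst p) t k"
          "\<And>t. t \<in> {a..b} \<Longrightarrow> val V t k = val (snd p) t k"
        using piece[of a k b] by blast
      have "AE t in lebesgue. (t, k) \<in> dom (fst p) \<longrightarrow>
        (val (fst p) t k, val (snd p) t k) \<in> flow_set S \<and>
        ((\<lambda>\<tau>. val (fst p) \<tau> k) has_vector_derivative
            flow_map S (val (fst p) t k, val (snd p) t k)) (at t within level (fst p) k)"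
        by (rule solution_pairD(7)[OF sol[OF p(1)]])
      then show "AE t in lebesgue. a < t \<longrightarrow> t < b \<longrightarrow> ?flow t"
      proof eventually_elim
        case (elim t)
        show ?case
        proof (intro impI)
          assume t: "a < t" "t < b"
          then have "(t, k) \<in> dom (fst p)"
            using p(2) unfolding level_def by (simp add: subset_iff)
          then have fl: "(val (fst p) t k, val (snd p) t k) \<in> flow_set S"
            and deriv: "((\<lambda>\<tau>. val (fst p) \<tau> k) has_vector_derivative
              flow_map S (val (fst p) t k, val (snd p) t k)) (at t within level (fst p) k)"
            using elim by auto
          \<comment> \<open>Shrinking to an open interval turns the derivative within the level of
            \<open>fst p\<close> into an ordinary one. It no longer depends on how far that level
            reaches and passes to the larger level of \<open>X\<close>.\<close>
          have "((\<lambda>\<tau>. val (fst p) \<tau> k) has_vector_derivative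
              flow_map S (val (fst p) t k, val (snd p) t k)) (at t within {a<..<b})"
            using deriv by (rule has_vector_derivative_within_subset) (use p(2) in auto)
          moreover have "at t within {a<..<b} = at t"
            using t by (intro at_within_open) auto
          ultimately have "((\<lambda>\<tau>. val (fst p) \<tau> k) has_vector_derivative
              flow_map S (val (fst p) t k, val (snd p) t k)) (at t)"
            by simp
          then have "((\<lambda>\<tau>. val X \<tau> k) has_vector_derivative
              flow_map S (val (fst p) t k, val (snd p) t k)) (at t)"
            by (rule has_vector_derivative_transform_within_open[where S = "{a<..<b}"])
              (simp_all add: t p(3))
          then show "?flow t"
            using fl t by (simp add: p(3,4) has_vector_derivative_at_within)
        qed
      qed
    qed
    then show ?thesis
      by (simp add: level_def)
  qed
  moreover have "(val X t k, val V t k) \<in> jump_set S \<and>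
        val X t (Suc k) = jump_map S (val X t k, val V t k)"
    if tk: "(t, k) \<in> dom X \<and> (t, Suc k) \<in> dom X" for t k
  proof -
    obtain p where p: "p \<in> C" "(t, k) \<in> dom (fst p)" "(t, Suc k) \<in> dom (fst p)"
      using member2 tk by blast
    then show ?thesis
      using agree[OF p(1,2)] agree[OF p(1,3)] solution_pairD(8,9)[OF sol[OF p(1)] p(2,3)]
      by simp
  qed
  ultimately show ?thesis
    unfolding solution_pair_def X_def[symmetric] V_def[symmetric] using dom_V by blast
qed

lemma maximal_extension_exists:
  assumes "solution_pair S x v"
  shows "\<exists>x' v'. maximal_solution_pair S x' v' \<and> x \<subseteq>\<^sub>m x' \<and> v \<subseteq>\<^sub>m v'"
proof -
  define P :: "('a hybrid_signal \<times> 'b hybrid_signal) \<Rightarrow> _ \<Rightarrow> bool"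
    where "P p q \<longleftrightarrow> fst p \<subseteq>\<^sub>m fst q \<and> snd p \<subseteq>\<^sub>m snd q" for p q
  define A where "A = {p. solution_pair S (fst p) (snd p) \<and> P (x, v) p}"
  have P_trans: "P p r" if "P p q" "P q r" for p q r
    using that map_le_trans[of "fst p" "fst q" "fst r"] map_le_trans[of "snd p" "snd q" "snd r"]
    by (simp add: P_def)
  have "\<exists>m\<in>A. \<forall>a\<in>A. P m a \<longrightarrow> a = m"
  proof (rule predicate_Zorn)
    show "partial_order_on A (relation_of P A)"
    proof (rule partial_order_on_relation_ofI)
      show "P a a" for a
        by (simp add: P_def)
      show "P a c" if "P a b" "P b c" for a b c
        using P_trans that .
      show "a = b" if "P a b" "P b a" for a b
        using that by (auto simp: P_def prod_eq_iff intro: map_le_antisym)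
    qed
    fix C assume C: "C \<in> Chains (relation_of P A)"
    show "\<exists>u\<in>A. \<forall>a\<in>C. P a u"
    proof (cases "C = {}")
      case True
      then show ?thesis
        using assms by (intro bexI[of _ "(x, v)"]) (auto simp: A_def P_def)
    next
      case False
      have chain: "P p q \<or> P q p" and A: "p \<in> A" if "p \<in> C" "q \<in> C" for p q
        using C that by (auto simp: Chains_def relation_of_def)
      have sol: "solution_pair S (fst p) (snd p)" if "p \<in> C" for p
        using A[OF that that] by (simp add: A_def)
      let ?u = "(chain_lub (fst ` C), chain_lub (snd ` C))"
      have upper: "P p ?u" if "p \<in> C" for p
        using that chain unfolding P_def by (auto intro!: chain_lub_upper)
      have "solution_pair S (fst ?u) (snd ?u)"
        using solution_pair_chain_lub[OF False sol] chain unfolding P_def by simp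
      moreover obtain p where "p \<in> C"
        using False by blast
      then have "P (x, v) ?u"
        using P_trans[OF _ upper] A unfolding A_def by blast
      ultimately show ?thesis
        using upper by (intro bexI[of _ ?u]) (simp_all add: A_def)
    qed
  qed
  then obtain m where m: "m \<in> A" "\<And>a. a \<in> A \<Longrightarrow> P m a \<Longrightarrow> a = m"
    by blast
  have "maximal_solution_pair S (fst m) (snd m)"
    unfolding maximal_solution_pair_def
  proof (intro conjI allI impI)
    show "solution_pair S (fst m) (snd m)"
      using m(1) by (simp add: A_def)
    fix x' v' assume *: "solution_pair S x' v' \<and> fst m \<subseteq>\<^sub>m x' \<and> snd m \<subseteq>\<^sub>m v'"
    then have "P m (x', v')"
      by (simp add: P_def)
    moreover have "(x', v') \<in> A"
      using m(1) * P_trans[OF _ \<open>P m (x', v')\<close>] by (auto simp: A_def)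
    ultimately have "(x', v') = m"
      using m(2) by blast
    then show "x' = fst m" "v' = snd m"
      by auto
  qed
  then show ?thesis
    using m(1) by (auto simp: A_def P_def)
qed

section \<open>Restriction to subsystems\<close>

lemma block_nth [simp]: "block b i x $ c = (if b c = i then x $ c else 0)"
  by (simp add: block_def)

lemma bounded_linear_block: "bounded_linear (block b i)"
  by (intro linear_conv_bounded_linear[THEN iffD1]) (auto simp: linear_iff vec_eq_iff)

lemma norm_block_le: "norm (block b i x) \<le> norm x"
  by (rule norm_le_componentwise_cart) simp

lemma block_diff_block: "block b j (x - block b i x) = (if j = i then 0 else block b j x)"
  by (auto simp: vec_eq_iff)

lemma norm_le_sum_block:
  fixes b :: "'m::finite \<Rightarrow> 'n::finite"
  shows "norm x \<le> (\<Sum>i\<in>UNIV. norm (block b i x))"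
proof -
  have "x = (\<Sum>i\<in>UNIV. block b i x)"
    by (simp add: vec_eq_iff sum.delta)
  then show ?thesis
    using norm_sum[of "\<lambda>i. block b i x" UNIV] by simp
qed

lemma block_stack: "y i \<in> block_space b i \<Longrightarrow> block b i (stack b y) = y i"
  by (auto simp: vec_eq_iff stack_def block_space_def)

lemma abs_cont_on_dominated:
  assumes "abs_cont_on a b f" "\<And>s t. norm (g s - g t) \<le> norm (f s - f t)"
  shows "abs_cont_on a b g"
  unfolding abs_cont_on_def
proof (intro allI impI)
  fix e :: real assume "0 < e"
  then obtain d where d: "d > 0" and f: "\<And>\<D>. \<D> division_of \<Union>\<D> \<Longrightarrow> \<Union>\<D> \<subseteq> {a..b} \<Longrightarrow>
      (\<Sum>I\<in>\<D>. measure lborel I) < d \<Longrightarrow> (\<Sum>I\<in>\<D>. norm (f (Sup I) - f (Inf I))) < e"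
    using assms(1) unfolding abs_cont_on_def by meson
  have "(\<Sum>I\<in>\<D>. norm (g (Sup I) - g (Inf I))) < e"
    if "\<D> division_of \<Union>\<D>" "\<Union>\<D> \<subseteq> {a..b}" "(\<Sum>I\<in>\<D>. measure lborel I) < d" for \<D>
    using f[OF that] by (rule le_less_trans[rotated]) (intro sum_mono assms(2))
  then show "\<exists>d>0. \<forall>\<D>. \<D> division_of \<Union>\<D> \<and> \<Union>\<D> \<subseteq> {a..b} \<and> (\<Sum>I\<in>\<D>. measure lborel I) < d \<longrightarrow>
      (\<Sum>I\<in>\<D>. norm (g (Sup I) - g (Inf I))) < e"
    using d by blast
qed

lemma abs_cont_on_imp_continuous_on:
  assumes "abs_cont_on a b h"
  shows "continuous_on {a..b} h"
  unfolding continuous_on_iff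
proof (intro ballI allI impI)
  fix s e :: real assume s: "s \<in> {a..b}" and "0 < e"
  then obtain d where d: "d > 0" and h: "\<And>\<D>. \<D> division_of \<Union>\<D> \<Longrightarrow> \<Union>\<D> \<subseteq> {a..b} \<Longrightarrow>
      (\<Sum>I\<in>\<D>. measure lborel I) < d \<Longrightarrow> (\<Sum>I\<in>\<D>. norm (h (Sup I) - h (Inf I))) < e"
    using assms unfolding abs_cont_on_def by meson
  have less: "norm (h q - h p) < e" if pq: "p \<in> {a..b}" "q \<in> {a..b}" "p \<le> q" "q - p < d" for p q
  proof -
    \<comment> \<open>For a division into a single interval the sum in the definition is just the
      increment to be bounded.\<close>
    have "{{p..q}} division_of {p..q}"
      using division_of_self[of p q] pq(3) by simp
    then have "(\<Sum>I\<in>{{p..q}}. norm (h (Sup I) - h (Inf I))) < e"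
      using pq by (intro h) auto
    then show ?thesis
      using pq(3) by simp
  qed
  have "dist (h t) (h s) < e" if "t \<in> {a..b}" "dist t s < d" for t
    using less[of t s] less[of s t] s that
    by (cases "s \<le> t") (auto simp: dist_norm norm_minus_commute)
  then show "\<exists>d>0. \<forall>t\<in>{a..b}. dist t s < d \<longrightarrow> dist (h t) (h s) < e"
    using d by blast
qed

text \<open>States of the neighbours act as inputs of a subsystem, and the norm estimates below are
  stated for hybrid inputs. Continuity on compact intervals provides both measurability and local
  boundedness.\<close>

lemma hybrid_arc_imp_input:
  fixes x :: "'a::euclidean_space hybrid_signal"
  assumes x: "hybrid_arc x"
  shows "hybrid_input x"
proof -
  note signal = hybrid_arcD(1)[OF x]
  have sub: "{a..b} \<subseteq> level x k" if "a \<in> level x k" "b \<in> level x k" for a b k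
    using is_interval_level[OF signal, of k] that unfolding is_interval_1
    by (meson atLeastAtMost_iff subsetI)
  have cont: "continuous_on {a..b} (\<lambda>t. val x t k)" if "a \<in> level x k" "b \<in> level x k" for a b k
    by (intro abs_cont_on_imp_continuous_on hybrid_arcD(2)[OF x] sub that)
  show ?thesis
    unfolding hybrid_input_def
  proof (intro conjI allI impI signal)
    fix k
    show "(\<lambda>t. val x t k) \<in> borel_measurable (lebesgue_on (level x k))"
    proof (rule measurable_lebesgue_on_interval)
      show "is_interval (level x k)"
        by (rule is_interval_level[OF signal])
      show "(\<lambda>t. val x t k) \<in> borel_measurable (lebesgue_on {a..b})"
        if "a \<in> level x k" "b \<in> level x k" for a b
        by (intro continuous_imp_measurable_on_sets_lebesgue cont that) auto
    qed
    fix J assume J: "compact J \<and> J \<subseteq> level x k"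
    show "\<exists>B. AE t in lebesgue_on J. norm (val x t k) \<le> B"
    proof (cases "J = {}")
      case True
      then show ?thesis
        by (auto simp: AE_restrict_space_iff)
    next
      case False
      obtain a where a: "a \<in> J" "\<And>t. t \<in> J \<Longrightarrow> a \<le> t"
        using compact_attains_inf[of J] J False by metis
      obtain b where b: "b \<in> J" "\<And>t. t \<in> J \<Longrightarrow> t \<le> b"
        using compact_attains_sup[of J] J False by metis
      have "continuous_on {a..b} (\<lambda>t. val x t k)"
        using a b J by (intro cont) auto
      then have "bounded ((\<lambda>t. val x t k) ` {a..b})"
        by (intro compact_imp_bounded compact_continuous_image) auto
      then obtain B where "\<forall>y\<in>(\<lambda>t. val x t k) ` {a..b}. norm y \<le> B"
        unfolding bounded_iff by blast
      then have "AE t in lebesgue_on J. norm (val x t k) \<le> B"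
        using a b by (intro AE_I2) auto
      then show ?thesis
        by blast
    qed
  qed
qed

definition block_signal :: "('m::finite \<Rightarrow> 'n) \<Rightarrow> 'n \<Rightarrow> (real^'m) hybrid_signal \<Rightarrow> (real^'m) hybrid_signal"
  where "block_signal b i x = map_option (block b i) \<circ> x"

text \<open>Subtracting the block makes the \<open>i\<close>-th block of the first component zero,
  as the input space of the subsystem demands. Adding the block of \<open>i\<close> again restores
  the overall state.\<close>

definition subsystem_input :: "('m::finite, 'n, 'p::finite) network \<Rightarrow> 'n \<Rightarrow> (real^'m) hybrid_signal
    \<Rightarrow> (real^'p) hybrid_signal \<Rightarrow> ((real^'m) \<times> (real^'p)) hybrid_signal"
  where "subsystem_input W i x u = (\<lambda>z. if z \<in> dom x
    then Some (the (x z) - block (owner W) i (the (x z)), the (u z)) else None)"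

lemma dom_block_signal [simp]: "dom (block_signal b i x) = dom x"
  by (auto simp: block_signal_def)

lemma dom_subsystem_input [simp]: "dom (subsystem_input W i x u) = dom x"
  by (auto simp: subsystem_input_def split: if_splits)

lemma level_block_signal [simp]: "level (block_signal b i x) k = level x k"
  by (simp only: level_def dom_block_signal)

lemma level_subsystem_input [simp]: "level (subsystem_input W i x u) k = level x k"
  by (simp only: level_def dom_subsystem_input)

lemma val_block_signal: "(t, k) \<in> dom x \<Longrightarrow> val (block_signal b i x) t k = block b i (val x t k)"
  by (auto simp: block_signal_def)

lemma val_subsystem_input:
  "(t, k) \<in> dom x \<Longrightarrow>
    val (subsystem_input W i x u) t k = (val x t k - block (owner W) i (val x t k), val u t k)"
  by (simp add: subsystem_input_def)

lemma hybrid_arc_block_signal: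
  assumes "hybrid_arc x"
  shows "hybrid_arc (block_signal b i x)"
  unfolding hybrid_arc_def
proof (intro conjI allI impI)
  show "is_hybrid_signal (block_signal b i x)"
    using hybrid_arcD(1)[OF assms] by (simp only: is_hybrid_signal_def dom_block_signal)
  fix k s t assume st: "{s..t} \<subseteq> level (block_signal b i x) k"
  interpret bounded_linear "block b i"
    by (rule bounded_linear_block)
  have "abs_cont_on s t (\<lambda>t. val x t k)"
    using hybrid_arcD(2)[OF assms] st by simp
  then have "abs_cont_on s t (\<lambda>t. block b i (val x t k))"
    by (rule abs_cont_on_dominated) (simp add: diff[symmetric] norm_block_le)
  moreover have "block b i (val x r k) = val (block_signal b i x) r k" if "r \<in> {s..t}" for r
  proof -
    have "(r, k) \<in> dom x"
      using st that unfolding level_def dom_block_signal by blast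
    then show ?thesis
      by (rule val_block_signal[symmetric])
  qed
  ultimately show "abs_cont_on s t (\<lambda>t. val (block_signal b i x) t k)"
    by (rule abs_cont_on_cong[rotated])
qed

lemma hybrid_input_subsystem_input:
  assumes x: "hybrid_arc x" and u: "hybrid_input u" and dom: "dom u = dom x"
  shows "hybrid_input (subsystem_input W i x u)"
proof -
  let ?v = "subsystem_input W i x u"
  let ?f = "\<lambda>k t. (val x t k - block (owner W) i (val x t k), val u t k)"
  note x' = hybrid_arc_imp_input[OF x]
  have level_u: "level u k = level x k" for k
    by (simp only: level_def dom)
  have eq: "val ?v t k = ?f k t" if "t \<in> level x k" for t k
    using that val_subsystem_input[of t k x W i u] by (simp only: level_def mem_Collect_eq)
  show ?thesis
    unfolding hybrid_input_def
  proof (intro conjI allI impI)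
    show "is_hybrid_signal ?v"
      using hybrid_arcD(1)[OF x] by (simp only: is_hybrid_signal_def dom_subsystem_input)
    fix k
    have "continuous_on UNIV (block (owner W) i)"
      by (rule linear_continuous_on[OF bounded_linear_block])
    then have "block (owner W) i \<in> borel_measurable borel"
      by (rule borel_measurable_continuous_onI)
    then have "(\<lambda>t. block (owner W) i (val x t k)) \<in> borel_measurable (lebesgue_on (level x k))"
      by (rule measurable_compose[OF hybrid_inputD(2)[OF x']])
    then have "?f k \<in> borel_measurable (lebesgue_on (level x k))"
      using hybrid_inputD(2)[OF x', of k] hybrid_inputD(2)[OF u, of k] unfolding level_u
      by (intro borel_measurable_Pair borel_measurable_diff)
    then show "(\<lambda>t. val ?v t k) \<in> borel_measurable (lebesgue_on (level ?v k))"
      using eq by (subst measurable_cong[where g = "?f k"]) auto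
    fix J assume "compact J \<and> J \<subseteq> level ?v k"
    then have J: "compact J" "J \<subseteq> level x k"
      by auto
    obtain B where B: "AE t in lebesgue_on J. norm (val x t k) \<le> B"
      using hybrid_inputD(3)[OF x' J] by blast
    obtain B' where B': "AE t in lebesgue_on J. norm (val u t k) \<le> B'"
      using hybrid_inputD(3)[OF u J(1)] J(2) unfolding level_u by blast
    have "AE t in lebesgue_on J. t \<in> J"
      by (rule AE_I2) simp
    then have "AE t in lebesgue_on J. norm (val ?v t k) \<le> 2 * B + B'"
      using B B'
    proof eventually_elim
      case (elim t)
      have "norm (?f k t) \<le> norm (val x t k - block (owner W) i (val x t k)) + norm (val u t k)"
        by (rule norm_Pair_le)
      also have "\<dots> \<le> (norm (val x t k) + norm (block (owner W) i (val x t k))) + norm (val u t k)"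
        by (intro add_right_mono norm_triangle_ineq4)
      also have "\<dots> \<le> 2 * B + B'"
        using norm_block_le[of "owner W" i "val x t k"] elim by linarith
      finally show ?case
        using eq elim(1) J(2) by auto
    qed
    then show "\<exists>B. AE t in lebesgue_on J. norm (val ?v t k) \<le> B"
      by blast
  qed
qed

lemma hybrid_network_subset_block_space:
  assumes "hybrid_network W"
  shows "substates W i \<subseteq> block_space (owner W) i"
proof (rule openin_imp_subset)
  show "openin (top_of_set (block_space (owner W) i)) (substates W i)"
    using assms by (simp add: hybrid_network_def)
qed

lemma subsystem_simps [simp]:
  "state_space (subsystem W i) = substates W i"
  "(w, u) \<in> input_space (subsystem W i) \<longleftrightarrow> block (owner W) i w = 0 \<and>
     (\<forall>j. j \<noteq> i \<longrightarrow> block (owner W) j w \<in> substates W j) \<and> u \<in> inputs W"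
  "(y, (w, u)) \<in> flow_set (subsystem W i) \<longleftrightarrow> (y + w, u) \<in> flow_sets W i"
  "(y, (w, u)) \<in> jump_set (subsystem W i) \<longleftrightarrow> (y + w, u) \<in> jump_sets W i"
  "flow_map (subsystem W i) (y, (w, u)) = flow_maps W i (y + w, u)"
  "jump_map (subsystem W i) (y, (w, u)) = jump_maps W i (y + w, u)"
  by (auto simp: subsystem_def)

lemma overall_simps [simp]:
  "state_space (overall W) = states W"
  "input_space (overall W) = inputs W"
  "z \<in> flow_set (overall W) \<longleftrightarrow> (\<forall>i. z \<in> flow_sets W i)"
  "z \<in> jump_set (overall W) \<longleftrightarrow> (\<exists>i. z \<in> jump_sets W i)"
  "flow_map (overall W) z = stack (owner W) (\<lambda>i. flow_maps W i z)"
  by (auto simp: overall_def)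

text \<open>A point of the union of the jump sets lies in each of them, so the overall jump map
  never takes its branch that leaves a block unchanged.\<close>

lemma block_jump_map_overall:
  assumes W: "hybrid_network W" and jumps: "\<And>i j. jump_sets W i = jump_sets W j"
    and z: "z \<in> jump_set (overall W)"
  shows "block (owner W) i (jump_map (overall W) z) = jump_maps W i z"
    "jump_maps W i z \<in> substates W i"
proof -
  have z': "z \<in> jump_sets W j" for j
    using z jumps by auto
  then show "jump_maps W i z \<in> substates W i" for i
    using W by (auto simp: hybrid_network_def)
  then have "jump_maps W i z \<in> block_space (owner W) i"
    using hybrid_network_subset_block_space[OF W] by blast
  moreover have "jump_map (overall W) z = stack (owner W) (\<lambda>i. jump_maps W i z)"
    using z' by (cases z) (simp add: overall_def)
  ultimately show "block (owner W) i (jump_map (overall W) z) = jump_maps W i z"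
    by (simp add: block_stack)
qed

text \<open>The overall flow set is the intersection of the flow sets, so all subsystems flow
  together, and the bounded linear map \<open>block\<close> carries derivatives over. For jumps, and
  for an initial point in the overall jump set, the common jump set makes every subsystem take
  part.\<close>

lemma solution_pair_subsystem:
  assumes W: "hybrid_network W" and jumps: "\<And>i j. jump_sets W i = jump_sets W j"
    and sol: "solution_pair (overall W) x u"
  shows "solution_pair (subsystem W i) (block_signal (owner W) i x) (subsystem_input W i x u)"
proof -
  let ?x = "block_signal (owner W) i x" and ?v = "subsystem_input W i x u"
  note sol' = solution_pairD[OF sol]
  have x_states: "block (owner W) j (val x t k) \<in> substates W j" if "(t, k) \<in> dom x" for t k j
  proof -
    have "val x t k \<in> ran x"
      using that by (auto intro: ranI)
    then show ?thesis
      using sol'(2) by (auto simp: states_def)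
  qed
  have u_inputs: "val u t k \<in> inputs W" if "(t, k) \<in> dom x" for t k
  proof -
    have "val u t k \<in> ran u"
      using that unfolding sol'(5)[symmetric] by (auto intro: ranI)
    then show ?thesis
      using sol'(4) by auto
  qed
  have zero: "(0, 0) \<in> dom x"
    by (rule time_domain_zero[OF solution_pair_time_domain[OF sol]])
  show ?thesis
    unfolding solution_pair_def
  proof (intro conjI allI impI)
    show "hybrid_arc ?x"
      by (rule hybrid_arc_block_signal[OF sol'(1)])
    show "hybrid_input ?v"
      by (rule hybrid_input_subsystem_input[OF sol'(1,3,5)])
    show "dom ?x = dom ?v"
      by (simp only: dom_block_signal dom_subsystem_input)
    show "ran ?x \<subseteq> state_space (subsystem W i)"
    proof
      fix y assume "y \<in> ran ?x"
      then obtain t k where tk: "?x (t, k) = Some y"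
        by (auto simp: ran_def)
      then have "(t, k) \<in> dom x"
        using dom_block_signal[of "owner W" i x] by blast
      then show "y \<in> state_space (subsystem W i)"
        using x_states[of t k i] val_block_signal[of t k x "owner W" i] tk by simp
    qed
    show "ran ?v \<subseteq> input_space (subsystem W i)"
    proof
      fix y assume "y \<in> ran ?v"
      then obtain t k where tk: "?v (t, k) = Some y"
        by (auto simp: ran_def)
      then have dom: "(t, k) \<in> dom x"
        using dom_subsystem_input[of W i x u] by blast
      then show "y \<in> input_space (subsystem W i)"
        using x_states[OF dom] u_inputs[OF dom] val_subsystem_input[OF dom, of W i u] tk
        by (simp add: block_diff_block)
    qed
    show "(val ?x 0 0, val ?v 0 0) \<in> flow_set (subsystem W i) \<union> jump_set (subsystem W i)"
    proof -
      have "z \<in> jump_set (overall W) \<longleftrightarrow> z \<in> jump_sets W i" for z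
        using jumps by auto
      then show ?thesis
        using sol'(6) unfolding val_block_signal[OF zero] val_subsystem_input[OF zero] by auto
    qed
    show "AE t in lebesgue. (t, k) \<in> dom ?x \<longrightarrow>
        (val ?x t k, val ?v t k) \<in> flow_set (subsystem W i) \<and>
        ((\<lambda>\<tau>. val ?x \<tau> k) has_vector_derivative flow_map (subsystem W i) (val ?x t k, val ?v t k))
           (at t within level ?x k)" for k
      using sol'(7)[of k]
    proof eventually_elim
      case (elim t)
      show ?case
        unfolding dom_block_signal level_block_signal
      proof
        assume dom: "(t, k) \<in> dom x"
        then have fl: "(val x t k, val u t k) \<in> flow_sets W j" for j
          using elim by auto
        have "flow_maps W i (val x t k, val u t k) \<in> block_space (owner W) i"
          using W fl[of i] by (auto simp: hybrid_network_def image_subset_iff)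
        then have "block (owner W) i (flow_map (overall W) (val x t k, val u t k))
            = flow_maps W i (val x t k, val u t k)"
          by (simp add: block_stack)
        then have "((\<lambda>\<tau>. block (owner W) i (val x \<tau> k)) has_vector_derivative
            flow_maps W i (val x t k, val u t k)) (at t within level x k)"
          using bounded_linear.has_vector_derivative[OF bounded_linear_block] elim dom by metis
        then have "((\<lambda>\<tau>. val ?x \<tau> k) has_vector_derivative
            flow_maps W i (val x t k, val u t k)) (at t within level x k)"
          by (rule has_vector_derivative_transform[rotated 2])
            (use dom in \<open>simp_all only: level_def mem_Collect_eq val_block_signal\<close>)
        then show "(val ?x t k, val ?v t k) \<in> flow_set (subsystem W i) \<and>
          ((\<lambda>\<tau>. val ?x \<tau> k) has_vector_derivative flow_map (subsystem W i) (val ?x t k, val ?v t k))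
            (at t within level x k)"
          using fl[of i] unfolding val_block_signal[OF dom] val_subsystem_input[OF dom] by simp
      qed
    qed
    fix t k assume "(t, k) \<in> dom ?x \<and> (t, Suc k) \<in> dom ?x"
    then have dom: "(t, k) \<in> dom x" "(t, Suc k) \<in> dom x"
      unfolding dom_block_signal by auto
    note jump = sol'(8)[OF dom] sol'(9)[OF dom]
    show "(val ?x t k, val ?v t k) \<in> jump_set (subsystem W i)"
      unfolding val_block_signal[OF dom(1)] val_subsystem_input[OF dom(1)]
      using jump(1) jumps by auto
    show "val ?x t (Suc k) = jump_map (subsystem W i) (val ?x t k, val ?v t k)"
      unfolding val_block_signal[OF dom(1)] val_subsystem_input[OF dom(1)]
        val_block_signal[OF dom(2)] jump(2)
      using block_jump_map_overall(1)[OF W jumps jump(1)] by simp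
  qed
qed

section \<open>The norm of hybrid signals\<close>

text \<open>Comparisons are made before the conversion to reals, since \<open>enn2real\<close> sends
  infinity to \<open>0\<close> and is monotone only where the larger value is finite. At points of
  the domain finiteness is \<open>hybrid_enorm_less_top\<close>.\<close>

definition hybrid_enorm :: "'a::euclidean_space hybrid_signal \<Rightarrow> real \<Rightarrow> nat \<Rightarrow> ennreal" where
  "hybrid_enorm u t k = max
     (SUP l. esssup
        (lebesgue_on {s. (s, l) \<in> dom u - jump_times u \<and> s + real l \<le> t + real k})
        (\<lambda>s. ennreal (norm (val u s l))))
     (SUP (s, l) \<in> {(s, l) \<in> jump_times u. s + real l \<le> t + real k}.
        ennreal (norm (val u s l)))"

lemma hybrid_norm_eq: "hybrid_norm u t k = enn2real (hybrid_enorm u t k)"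
  by (simp only: hybrid_norm_def hybrid_enorm_def)

lemma hybrid_norm_nonneg: "0 \<le> hybrid_norm u t k"
  by (simp add: hybrid_norm_eq)

lemma sets_nonjump_level:
  assumes "is_hybrid_signal u"
  shows "{s. (s, l) \<in> dom u - jump_times u \<and> s + real l \<le> c} \<in> sets lebesgue"
proof -
  \<comment> \<open>The jump times on level \<open>l\<close> are its points shared with the next
    level, so only differences and intersections of intervals occur.\<close>
  have "{s. (s, l) \<in> dom u - jump_times u \<and> s + real l \<le> c} =
      level u l \<inter> {..c - real l} - level u (Suc l)"
    by (auto simp: level_def jump_times_def)
  moreover have "level u m \<in> sets lebesgue" for m
    by (intro interval_lebesgue_sets is_interval_level assms)
  then have "level u l \<inter> {..c - real l} - level u (Suc l) \<in> sets lebesgue"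
    by (intro sets.Diff sets.Int) auto
  ultimately show ?thesis
    by (simp only:)
qed

lemma measurable_norm_nonjump_level:
  assumes "hybrid_input u"
  shows "(\<lambda>s. ennreal (norm (val u s l))) \<in> borel_measurable
    (lebesgue_on {s. (s, l) \<in> dom u - jump_times u \<and> s + real l \<le> c})" (is "_ \<in> borel_measurable (lebesgue_on ?A)")
proof -
  have "?A \<subseteq> level u l"
    unfolding level_def by blast
  then have "(\<lambda>s. val u s l) \<in> borel_measurable (lebesgue_on ?A)"
    using hybrid_inputD(2)[OF assms] by (rule measurable_restrict_mono[rotated])
  then show ?thesis
    by simp
qed

lemma esssup_lebesgue_on_mono:
  fixes f :: "real \<Rightarrow> ennreal"
  assumes "f \<in> borel_measurable (lebesgue_on A)" "A \<subseteq> B" "A \<in> sets lebesgue" "B \<in> sets lebesgue"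
  shows "esssup (lebesgue_on A) f \<le> esssup (lebesgue_on B) f"
proof (rule esssup_I[OF assms(1)])
  have "AE s in lebesgue_on B. f s \<le> esssup (lebesgue_on B) f"
    by (rule esssup_AE)
  then show "AE s in lebesgue_on A. f s \<le> esssup (lebesgue_on B) f"
    using assms(2-4) by (auto simp: AE_restrict_space_iff elim!: eventually_mono)
qed

lemma hybrid_enorm_mono:
  assumes u: "hybrid_input u" and le: "r + real m \<le> t + real k"
  shows "hybrid_enorm u r m \<le> hybrid_enorm u t k"
  unfolding hybrid_enorm_def
proof (rule max.mono)
  show "(SUP l. esssup (lebesgue_on {s. (s, l) \<in> dom u - jump_times u \<and> s + real l \<le> r + real m})
        (\<lambda>s. ennreal (norm (val u s l)))) \<le>
      (SUP l. esssup (lebesgue_on {s. (s, l) \<in> dom u - jump_times u \<and> s + real l \<le> t + real k})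
        (\<lambda>s. ennreal (norm (val u s l))))"
    using le
    by (intro SUP_mono' esssup_lebesgue_on_mono measurable_norm_nonjump_level[OF u]
        sets_nonjump_level[OF hybrid_inputD(1)[OF u]]) auto
next
  show "(SUP (s, l) \<in> {(s, l) \<in> jump_times u. s + real l \<le> r + real m}. ennreal (norm (val u s l))) \<le>
      (SUP (s, l) \<in> {(s, l) \<in> jump_times u. s + real l \<le> t + real k}. ennreal (norm (val u s l)))"
    using le by (intro SUP_subset_mono) auto
qed

lemma hybrid_enorm_le:
  assumes u: "hybrid_input u"
    and B: "\<And>s l. (s, l) \<in> dom u \<Longrightarrow> s + real l \<le> t + real k \<Longrightarrow> norm (val u s l) \<le> B"
  shows "hybrid_enorm u t k \<le> ennreal B"
  unfolding hybrid_enorm_def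
proof (intro max.boundedI SUP_least)
  fix l
  show "esssup (lebesgue_on {s. (s, l) \<in> dom u - jump_times u \<and> s + real l \<le> t + real k})
        (\<lambda>s. ennreal (norm (val u s l))) \<le> ennreal B"
  proof (intro esssup_I measurable_norm_nonjump_level[OF u] AE_I2)
    fix s assume "s \<in> space (lebesgue_on {s. (s, l) \<in> dom u - jump_times u \<and> s + real l \<le> t + real k})"
    then have "(s, l) \<in> dom u" "s + real l \<le> t + real k"
      unfolding space_restrict_space by blast+
    then show "ennreal (norm (val u s l)) \<le> ennreal B"
      by (intro ennreal_leI B)
  qed
next
  fix z assume "z \<in> {(s, l) \<in> jump_times u. s + real l \<le> t + real k}"
  then obtain s l where z: "z = (s, l)" "(s, l) \<in> dom u" "s + real l \<le> t + real k"
    unfolding jump_times_def by blast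
  then show "(case z of (s, l) \<Rightarrow> ennreal (norm (val u s l))) \<le> ennreal B"
    unfolding z(1) prod.case by (intro ennreal_leI B)
qed

text \<open>The converse fails in general: a point that is not a jump time may be changed without
  affecting the norm, and a signal living at one point has norm \<open>0\<close> whatever its
  value.\<close>

lemma hybrid_norm_le:
  assumes "hybrid_input u" "0 \<le> B"
    and "\<And>s l. (s, l) \<in> dom u \<Longrightarrow> s + real l \<le> t + real k \<Longrightarrow> norm (val u s l) \<le> B"
  shows "hybrid_norm u t k \<le> B"
  unfolding hybrid_norm_eq using assms(2) hybrid_enorm_le[OF assms(1,3)] by (rule enn2real_leI)

lemma SUP_ennreal_less_top:
  fixes f :: "'a \<Rightarrow> ennreal"
  assumes "finite I" "\<And>i. i \<in> I \<Longrightarrow> f i < top" "\<And>i. i \<in> J \<Longrightarrow> i \<notin> I \<Longrightarrow> f i = 0"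
  shows "(SUP i\<in>J. f i) < top"
proof -
  have "(SUP i\<in>J. f i) \<le> (\<Sum>i\<in>I. f i)"
  proof (rule SUP_least)
    fix i assume "i \<in> J"
    then show "f i \<le> (\<Sum>i\<in>I. f i)"
      using assms(1,3) by (cases "i \<in> I") (auto intro: member_le_sum)
  qed
  also have "\<dots> < top"
    using assms(1,2) by simp
  finally show ?thesis .
qed

text \<open>Only the levels up to \<open>k\<close> contribute. On each of them the relevant part
  lies in a compact interval inside the level, and it has at most one jump time; hence finitely many
  finite quantities are compared.\<close>

lemma hybrid_enorm_less_top:
  assumes u: "hybrid_input u" and tk: "(t, k) \<in> dom u"
  shows "hybrid_enorm u t k < top"
proof -
  have htd: "hybrid_time_domain (dom u)"
    using hybrid_inputD(1)[OF u] by (simp add: is_hybrid_signal_def)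
  let ?A = "\<lambda>l. {s. (s, l) \<in> dom u - jump_times u \<and> s + real l \<le> t + real k}"
  let ?f = "\<lambda>l s. ennreal (norm (val u s l))"
  have sets_A: "?A l \<in> sets lebesgue" for l
    by (rule sets_nonjump_level[OF hybrid_inputD(1)[OF u]])
  have "(SUP l. esssup (lebesgue_on (?A l)) (?f l)) < top"
  proof (rule SUP_ennreal_less_top[of "{..k}"])
    fix l
    obtain a b where ab: "{s. (s, l) \<in> dom u \<and> s + real l \<le> t + real k} \<subseteq> {a..b}"
        "{a..b} \<times> {l} \<subseteq> dom u"
      using time_domain_before_compact[OF htd tk] by blast
    have "{a..b} \<subseteq> level u l"
      using ab(2) unfolding level_def by blast
    then obtain B where B: "AE s in lebesgue_on {a..b}. norm (val u s l) \<le> B"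
      using hybrid_inputD(3)[OF u compact_Icc] by blast
    have sub: "?A l \<subseteq> {a..b}"
      using ab(1) by blast
    have "AE s in lebesgue_on (?A l). ?f l s \<le> ennreal B"
      using B sub sets_A[of l]
      by (auto simp: AE_restrict_space_iff intro: ennreal_leI elim!: eventually_mono)
    then have "esssup (lebesgue_on (?A l)) (?f l) \<le> ennreal B"
      by (rule esssup_I[OF measurable_norm_nonjump_level[OF u]])
    then show "esssup (lebesgue_on (?A l)) (?f l) < top"
      by (rule le_less_trans) simp
  next
    fix l assume "l \<notin> {..k}"
    then have "?A l = {}"
      using time_domain_before(2)[OF htd tk] by fastforce
    then have "AE s in lebesgue_on (?A l). ?f l s \<le> 0"
      by (intro AE_I2) (simp only: space_restrict_space, blast)
    then have "esssup (lebesgue_on (?A l)) (?f l) \<le> 0"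
      by (rule esssup_I[OF measurable_norm_nonjump_level[OF u]])
    then show "esssup (lebesgue_on (?A l)) (?f l) = 0"
      by simp
  qed simp
  moreover have "(SUP (s, l) \<in> {(s, l) \<in> jump_times u. s + real l \<le> t + real k}. ?f l s) < top"
    (is "(SUP z \<in> ?J. _) < top")
  proof (rule SUP_ennreal_less_top)
    have "inj_on snd ?J"
      unfolding inj_on_def jump_times_def using time_domain_jump_unique[OF htd] by fastforce
    moreover have "snd ` ?J \<subseteq> {..k}"
      unfolding jump_times_def using time_domain_before(2)[OF htd tk] by fastforce
    then have "finite (snd ` ?J)"
      by (rule finite_subset) simp
    ultimately show "finite ?J"
      by (rule finite_imageD[rotated])
  qed auto
  ultimately show ?thesis
    unfolding hybrid_enorm_def by simp
qed

lemma hybrid_norm_mono: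
  assumes "hybrid_input u" "(t, k) \<in> dom u" "r + real m \<le> t + real k"
  shows "hybrid_norm u r m \<le> hybrid_norm u t k"
  unfolding hybrid_norm_eq
  by (intro enn2real_mono hybrid_enorm_mono hybrid_enorm_less_top assms)

lemma esssup_cong:
  assumes "\<And>s. s \<in> space M \<Longrightarrow> f s = g s"
  shows "esssup M f = esssup M g"
proof -
  have "f \<in> borel_measurable M \<longleftrightarrow> g \<in> borel_measurable M"
    by (rule measurable_cong[OF assms])
  moreover have "Limsup (ae_filter M) f = Limsup (ae_filter M) g"
    by (intro Limsup_eq AE_I2 assms)
  ultimately show ?thesis
    by (simp add: esssup_def)
qed

text \<open>Agreement of the jump times is a separate condition: whether \<open>(s, l)\<close> is
  one depends on \<open>(s, Suc l)\<close>, which may lie beyond \<open>(t, k)\<close>.\<close>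

lemma hybrid_norm_cong:
  assumes dom: "\<And>s l. s + real l \<le> t + real k \<Longrightarrow> (s, l) \<in> dom u \<longleftrightarrow> (s, l) \<in> dom v"
    and jump: "\<And>s l. s + real l \<le> t + real k \<Longrightarrow> (s, l) \<in> jump_times u \<longleftrightarrow> (s, l) \<in> jump_times v"
    and val: "\<And>s l. s + real l \<le> t + real k \<Longrightarrow> (s, l) \<in> dom u \<Longrightarrow> val u s l = val v s l"
  shows "hybrid_norm u t k = hybrid_norm v t k"
proof -
  have "{s. (s, l) \<in> dom u - jump_times u \<and> s + real l \<le> t + real k} =
      {s. (s, l) \<in> dom v - jump_times v \<and> s + real l \<le> t + real k}" for l
    using dom jump by blast
  moreover have "{(s, l) \<in> jump_times u. s + real l \<le> t + real k} =
      {(s, l) \<in> jump_times v. s + real l \<le> t + real k}"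
    using jump by blast
  moreover have "esssup (lebesgue_on {s. (s, l) \<in> dom u - jump_times u \<and> s + real l \<le> t + real k})
        (\<lambda>s. ennreal (norm (val u s l))) =
      esssup (lebesgue_on {s. (s, l) \<in> dom u - jump_times u \<and> s + real l \<le> t + real k})
        (\<lambda>s. ennreal (norm (val v s l)))" for l
  proof (rule esssup_cong)
    fix s assume "s \<in> space (lebesgue_on {s. (s, l) \<in> dom u - jump_times u \<and> s + real l \<le> t + real k})"
    then have "s + real l \<le> t + real k" "(s, l) \<in> dom u"
      unfolding space_restrict_space by blast+
    then show "ennreal (norm (val u s l)) = ennreal (norm (val v s l))"
      by (simp only: val)
  qed
  moreover have "(SUP (s, l) \<in> {(s, l) \<in> jump_times u. s + real l \<le> t + real k}.
        ennreal (norm (val u s l))) =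
      (SUP (s, l) \<in> {(s, l) \<in> jump_times u. s + real l \<le> t + real k}.
        ennreal (norm (val v s l)))"
  proof (rule SUP_cong[OF refl])
    fix z assume "z \<in> {(s, l) \<in> jump_times u. s + real l \<le> t + real k}"
    then obtain s l where z: "z = (s, l)" "(s, l) \<in> dom u" "s + real l \<le> t + real k"
      unfolding jump_times_def by blast
    then show "(case z of (s, l) \<Rightarrow> ennreal (norm (val u s l))) =
        (case z of (s, l) \<Rightarrow> ennreal (norm (val v s l)))"
      unfolding z(1) prod.case by (simp only: val)
  qed
  ultimately show ?thesis
    unfolding hybrid_norm_eq hybrid_enorm_def by (simp only:)
qed

section \<open>Interconnections\<close>

text \<open>The larger domain \<open>E'\<close> certifies that a jump at \<open>s\<close> is
  possible, so the order conditions are inherited from it. If \<open>E\<close> had a level above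
  \<open>l\<close>, its jump out of level \<open>l\<close> would also be one of \<open>E'\<close>,
  hence occur at \<open>s\<close>, and the point would not be new.\<close>

lemma hybrid_time_domain_insert_jump:
  assumes E: "hybrid_time_domain E" and E': "hybrid_time_domain E'" "E \<subseteq> E'"
    and s: "(s, l) \<in> E" "(s, Suc l) \<in> E'" and new: "(s, Suc l) \<notin> E"
  shows "hybrid_time_domain (insert (s, Suc l) E)" and "(r, Suc l) \<notin> E"
proof -
  have le: "m \<le> l" if rm: "(r, m) \<in> E" for r m
  proof (rule ccontr)
    assume "\<not> m \<le> l"
    then obtain q where q: "(q, l) \<in> E" "(q, Suc l) \<in> E"
      using time_domain_jump_below[OF E rm, of l] by auto
    then have "q = s"
      using time_domain_jump_unique[OF E'(1), of q l s] s E'(2) by blast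
    then show False
      using q new by simp
  qed
  then show "(r, Suc l) \<notin> E"
    by fastforce
  show "hybrid_time_domain (insert (s, Suc l) E)"
    unfolding hybrid_time_domain_iff time_domain_like_def
  proof (intro conjI allI impI)
    show "(0, 0) \<in> insert (s, Suc l) E"
      using time_domain_zero[OF E] by blast
    show "0 \<le> r" if "(r, m) \<in> insert (s, Suc l) E" for r m
      using that time_domain_nonneg[OF E'(1)] E'(2) s(2) by blast
    show "(r, m) \<in> insert (s, Suc l) E"
      if ab: "(a, m) \<in> insert (s, Suc l) E" "(b, m) \<in> insert (s, Suc l) E" "a \<le> r" "r \<le> b" for a b r m
    proof (cases "m = Suc l")
      case True
      then have "a = s" "b = s"
        using ab(1,2) le by force+
      then show ?thesis
        using True ab(3,4) by simp
    next
      case False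
      then have "(a, m) \<in> E" "(b, m) \<in> E"
        using ab(1,2) by auto
      then show ?thesis
        using time_domain_convex[OF E _ _ ab(3,4)] by blast
    qed
    show "a \<le> b" if "(a, k) \<in> insert (s, Suc l) E" "(b, m) \<in> insert (s, Suc l) E" "k < m" for a b k m
      using that time_domain_order[OF E'(1), of a k b m] E'(2) s(2) by blast
    show "\<exists>q. (q, m) \<in> insert (s, Suc l) E \<and> (q, Suc m) \<in> insert (s, Suc l) E"
      if "(r, Suc m) \<in> insert (s, Suc l) E" for r m
      using that s(1) time_domain_pred[OF E, of r m] by auto
  qed
qed

lemma AE_lebesgue_neq: "AE t in lebesgue. t \<noteq> (s :: real)"
proof -
  have "{s} \<in> null_sets lebesgue"
    by (intro null_sets_completionI countable_imp_null_set_lborel) simp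
  then have "AE t in lebesgue. t \<notin> {s}"
    by (rule AE_not_in)
  then show ?thesis
    by simp
qed

text \<open>The new level is a single point, hence null: the flow condition and the regularity
  conditions hold there trivially, and only the jump leading to it must be checked. Repeating the
  last input value keeps the input admissible.\<close>

lemma solution_pair_append_jump:
  assumes sol: "solution_pair S x v" and E': "hybrid_time_domain E'" "dom x \<subseteq> E'"
    and s: "(s, l) \<in> dom x" "(s, Suc l) \<in> E'" and new: "(s, Suc l) \<notin> dom x"
    and jump: "(val x s l, val v s l) \<in> jump_set S"
      "jump_map S (val x s l, val v s l) \<in> state_space S"
  shows "solution_pair S (x((s, Suc l) \<mapsto> jump_map S (val x s l, val v s l)))
    (v((s, Suc l) \<mapsto> val v s l))"
proof -
  define x' where "x' = x((s, Suc l) \<mapsto> jump_map S (val x s l, val v s l))"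
  define v' where "v' = v((s, Suc l) \<mapsto> val v s l)"
  note sol' = solution_pairD[OF sol]
  note htd = solution_pair_time_domain[OF sol]
  have dom_x': "dom x' = insert (s, Suc l) (dom x)" and dom_v': "dom v' = insert (s, Suc l) (dom x)"
    unfolding x'_def v'_def using sol'(5) by simp_all
  note htd' = hybrid_time_domain_insert_jump[OF htd E' s new]
  have signals: "is_hybrid_signal x'" "is_hybrid_signal v'"
    unfolding is_hybrid_signal_def dom_x' dom_v' by (rule htd'(1))+
  have old: "val x' t k = val x t k" "val v' t k = val v t k" if "(t, k) \<in> dom x" for t k
  proof -
    have "(t, k) \<noteq> (s, Suc l)"
      using that new by metis
    then show "val x' t k = val x t k" "val v' t k = val v t k"
      by (auto simp: x'_def v'_def)
  qed
  have level: "level x' k = (if k = Suc l then {s} else level x k)"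
      "level v' k = (if k = Suc l then {s} else level v k)" for k
    using htd'(2) unfolding level_def dom_x' dom_v' sol'(5) by auto
  have old_level: "val x' t k = val x t k \<and> val v' t k = val v t k" if "k \<noteq> Suc l" for t k
    using that by (simp add: x'_def v'_def)
  have "hybrid_arc x'"
    unfolding hybrid_arc_def
  proof (intro conjI allI impI signals)
    fix k a b assume ab: "{a..b} \<subseteq> level x' k"
    show "abs_cont_on a b (\<lambda>t. val x' t k)"
    proof (cases "k = Suc l")
      case True
      then have "a \<le> b \<Longrightarrow> a = s \<and> b = s"
        using ab level(1)[of k] by (simp add: subset_iff)
      then have "b \<le> a"
        by linarith
      then show ?thesis
        by (rule abs_cont_on_trivial)
    next
      case False
      then show ?thesis
        using hybrid_arcD(2)[OF sol'(1), of a b k] ab level(1)[of k] old_level by simp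
    qed
  qed
  moreover have "hybrid_input v'"
    unfolding hybrid_input_def
  proof (intro conjI allI impI signals)
    fix k
    show "(\<lambda>t. val v' t k) \<in> borel_measurable (lebesgue_on (level v' k))"
    proof (cases "k = Suc l")
      case True
      have "(\<lambda>t. val v' t k) \<in> borel_measurable (lebesgue_on {s})
          \<longleftrightarrow> (\<lambda>t. val v' s k) \<in> borel_measurable (lebesgue_on {s})"
        by (rule measurable_cong) simp
      then show ?thesis
        using True level(2)[of k] by simp
    next
      case False
      then show ?thesis
        using hybrid_inputD(2)[OF sol'(3), of k] level(2)[of k] old_level by simp
    qed
    fix J assume J: "compact J \<and> J \<subseteq> level v' k"
    show "\<exists>B. AE t in lebesgue_on J. norm (val v' t k) \<le> B"
    proof (cases "k = Suc l")
      case True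
      then have "AE t in lebesgue_on J. norm (val v' t k) \<le> norm (val v' s k)"
        using J level(2)[of k] by (intro AE_I2) auto
      then show ?thesis
        by blast
    next
      case False
      then show ?thesis
        using hybrid_inputD(3)[OF sol'(3), of J k] J level(2)[of k] old_level by simp
    qed
  qed
  moreover have "ran x' \<subseteq> state_space S"
    using sol'(2) jump(2) unfolding x'_def by (auto simp: ran_def)
  moreover have "ran v' \<subseteq> input_space S"
  proof -
    have "val v s l \<in> ran v"
      using s(1) unfolding sol'(5)[symmetric] by (auto intro: ranI)
    then show ?thesis
      using sol'(4) unfolding v'_def by (auto simp: ran_def)
  qed
  moreover have "dom x' = dom v'"
    by (simp only: dom_x' dom_v')
  moreover have "(val x' 0 0, val v' 0 0) \<in> flow_set S \<union> jump_set S"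
    using sol'(6) old_level[of 0 0] by simp
  moreover have "AE t in lebesgue. (t, k) \<in> dom x' \<longrightarrow>
        (val x' t k, val v' t k) \<in> flow_set S \<and>
        ((\<lambda>\<tau>. val x' \<tau> k) has_vector_derivative flow_map S (val x' t k, val v' t k))
           (at t within level x' k)" for k
  proof (cases "k = Suc l")
    case True
    have "(t, k) \<notin> dom x'" if "t \<noteq> s" for t
      using that htd'(2) True unfolding dom_x' by blast
    then show ?thesis
      using AE_lebesgue_neq[of s] by (auto elim!: eventually_mono)
  next
    case False
    then have "(t, k) \<in> dom x' \<longleftrightarrow> (t, k) \<in> dom x" for t
      unfolding dom_x' by blast
    then show ?thesis
      using sol'(7)[of k] False level(1)[of k] old_level by simp
  qed
  moreover have "(val x' t k, val v' t k) \<in> jump_set S \<and>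
        val x' t (Suc k) = jump_map S (val x' t k, val v' t k)"
    if tk: "(t, k) \<in> dom x' \<and> (t, Suc k) \<in> dom x'" for t k
  proof (cases "k = l")
    case True
    then have "t = s"
      using tk htd'(2) unfolding dom_x' by blast
    then show ?thesis
      using True jump(1) old[OF s(1)] by (simp add: x'_def)
  next
    case False
    then have dom: "(t, Suc k) \<in> dom x"
      using tk unfolding dom_x' by blast
    \<comment> \<open>No jump starts at the appended point: its target would lie in the old domain,
      which would then have to contain a point of level \<open>Suc l\<close>.\<close>
    moreover have "k \<noteq> Suc l"
    proof
      assume "k = Suc l"
      then have "l < Suc k"
        by simp
      then show False
        using time_domain_jump_below[OF htd dom] htd'(2) by blast
    qed
    ultimately have "(t, k) \<in> dom x"
      using tk unfolding dom_x' by blast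
    then show ?thesis
      using sol'(8,9)[of t k] dom old by simp
  qed
  ultimately show ?thesis
    unfolding solution_pair_def x'_def[symmetric] v'_def[symmetric] by blast
qed

text \<open>Membership in one jump set permits an overall jump, and the block images under the jump
  maps stay in the state sets, so the appended point would extend the maximal pair strictly. In the
  application \<open>E'\<close> is the domain of an extended subsystem solution.\<close>

lemma maximal_no_further_jump:
  assumes W: "hybrid_network W" and jumps: "\<And>i j. jump_sets W i = jump_sets W j"
    and max: "maximal_solution_pair (overall W) x u"
    and E': "hybrid_time_domain E'" "dom x \<subseteq> E'"
    and s: "(s, l) \<in> dom x" "(s, Suc l) \<in> E'"
    and jump: "(val x s l, val u s l) \<in> jump_sets W i"
  shows "(s, Suc l) \<in> dom x"
proof (rule ccontr)
  assume new: "(s, Suc l) \<notin> dom x"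
  let ?z = "(val x s l, val u s l)"
  have sol: "solution_pair (overall W) x u"
    using max by (simp add: maximal_solution_pair_def)
  have z: "?z \<in> jump_set (overall W)"
    using jump by auto
  have "block (owner W) j (jump_map (overall W) ?z) \<in> substates W j" for j
    using block_jump_map_overall[OF W jumps z] by metis
  then have "jump_map (overall W) ?z \<in> state_space (overall W)"
    by (simp add: states_def)
  then have "solution_pair (overall W) (x((s, Suc l) \<mapsto> jump_map (overall W) ?z))
      (u((s, Suc l) \<mapsto> val u s l))"
    by (intro solution_pair_append_jump[OF sol E' s new z])
  moreover have "x \<subseteq>\<^sub>m x((s, Suc l) \<mapsto> y)" "u \<subseteq>\<^sub>m u((s, Suc l) \<mapsto> w)" for y w
    using new solution_pairD(5)[OF sol] by (auto simp: map_le_def)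
  ultimately have "x((s, Suc l) \<mapsto> jump_map (overall W) ?z) = x"
    using max unfolding maximal_solution_pair_def by blast
  then have "(s, Suc l) \<in> dom x"
    by (metis domI fun_upd_same)
  then show False
    using new by simp
qed

section \<open>Transfer of the subsystem estimates to the blocks\<close>

text \<open>By \<open>time_domain_initial_segment\<close> the extension adds no point up to
  \<open>(t, k)\<close>. What remains is the classification of the old points as jump times or not,
  which \<open>no_jump\<close> preserves.\<close>

lemma hybrid_norm_extension:
  assumes E: "hybrid_time_domain (dom y)" "hybrid_time_domain (dom y')" "dom y \<subseteq> dom y'"
    and no_jump: "\<And>s l. (s, l) \<in> dom y \<Longrightarrow> (s, Suc l) \<in> dom y' \<Longrightarrow> (s, Suc l) \<in> dom y"
    and val: "\<And>s l. (s, l) \<in> dom y \<Longrightarrow> val y' s l = val y s l"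
    and tk: "(t, k) \<in> dom y"
  shows "hybrid_norm y' t k = hybrid_norm y t k"
proof (rule hybrid_norm_cong)
  fix s l assume le: "s + real l \<le> t + real k"
  show dom: "(s, l) \<in> dom y' \<longleftrightarrow> (s, l) \<in> dom y"
    using time_domain_initial_segment[OF E tk _ le] E(3) by blast
  show "(s, l) \<in> jump_times y' \<longleftrightarrow> (s, l) \<in> jump_times y"
    unfolding jump_times_def using dom no_jump[of s l] E(3) by blast
  show "val y' s l = val y s l" if "(s, l) \<in> dom y'"
    using that dom val by blast
qed

lemma block_bound:
  assumes W: "hybrid_network W" and jumps: "\<And>i j. jump_sets W i = jump_sets W j"
    and GS: "subsystem_pre_GS W i \<sigma> \<gamma> \<gamma>u"
    and max: "maximal_solution_pair (overall W) x u" and tk: "(t, k) \<in> dom x"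
  shows "norm (block (owner W) i (val x t k)) \<le> max (\<sigma> (norm (block (owner W) i (val x 0 0))))
    (max (MAX j \<in> UNIV - {i}. \<gamma> j (hybrid_norm (block_signal (owner W) j x) t k))
      (\<gamma>u (hybrid_norm u t k)))"
proof -
  let ?b = "block (owner W) i"
  have sol: "solution_pair (overall W) x u"
    using max by (simp add: maximal_solution_pair_def)
  note htd = solution_pair_time_domain[OF sol]
  obtain y v where yv: "maximal_solution_pair (subsystem W i) y v"
    and ext: "block_signal (owner W) i x \<subseteq>\<^sub>m y" "subsystem_input W i x u \<subseteq>\<^sub>m v"
    using maximal_extension_exists[OF solution_pair_subsystem[OF W jumps sol]] by blast
  have sol': "solution_pair (subsystem W i) y v"
    using yv by (simp add: maximal_solution_pair_def)
  note htd' = solution_pair_time_domain[OF sol']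
  have dom_v: "dom v = dom y"
    by (rule solution_pairD(5)[OF sol'])
  have sub: "dom x \<subseteq> dom y"
    using map_le_implies_dom_le[OF ext(1)] unfolding dom_block_signal .
  have y: "val y s l = ?b (val x s l)"
    and v: "v (s, l) = Some (val x s l - ?b (val x s l), val u s l)" if "(s, l) \<in> dom x" for s l
  proof -
    show "val y s l = ?b (val x s l)"
      using ext(1) val_block_signal[OF that] that unfolding map_le_def dom_block_signal by metis
    show "v (s, l) = Some (val x s l - ?b (val x s l), val u s l)"
      using ext(2) that unfolding map_le_def dom_subsystem_input
      by (auto simp: subsystem_input_def)
  qed
  have no_jump: "(s, Suc l) \<in> dom x" if s: "(s, l) \<in> dom x" "(s, Suc l) \<in> dom y" for s l
  proof -
    have "(val y s l, val v s l) \<in> jump_set (subsystem W i)"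
      using solution_pairD(8)[OF sol' _ s(2)] s(1) sub by blast
    then have "(val x s l, val u s l) \<in> jump_sets W i"
      using y[OF s(1)] v[OF s(1)] by simp
    then show ?thesis
      by (rule maximal_no_further_jump[OF W jumps max htd' sub s])
  qed
  have zero: "(0, 0) \<in> dom x"
    by (rule time_domain_zero[OF htd])
  have "val x 0 0 \<in> states W"
  proof -
    have "val x 0 0 \<in> ran x"
      using zero by (auto intro: ranI)
    then show ?thesis
      using solution_pairD(2)[OF sol] by auto
  qed
  then have "?b (val x 0 0) \<in> substates W i"
    by (simp add: states_def)
  moreover have "(y, v) \<in> solutions_from (subsystem W i) (?b (val x 0 0))"
    using yv y[OF zero] by (simp add: solutions_from_def)
  ultimately have "norm (val y t k) \<le> max (\<sigma> (norm (?b (val x 0 0))))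
    (max (MAX j \<in> UNIV - {i}. \<gamma> j (hybrid_norm (neighbour_signal W j v) t k))
      (\<gamma>u (hybrid_norm (external_signal v) t k)))"
    using GS tk sub unfolding subsystem_pre_GS_def by blast
  \<comment> \<open>Values need to be compared only on \<open>dom x\<close>, where block
    \<open>j\<close> survives the subtraction of block \<open>i\<close> because the indices
    differ.\<close>
  moreover have "hybrid_norm (neighbour_signal W j v) t k = hybrid_norm (block_signal (owner W) j x) t k"
    if "j \<in> UNIV - {i}" for j
  proof -
    have dom: "dom (neighbour_signal W j v) = dom y"
      unfolding dom_v[symmetric] by (auto simp: neighbour_signal_def)
    have "val (neighbour_signal W j v) s l = val (block_signal (owner W) j x) s l"
      if "(s, l) \<in> dom x" for s l
      using v[OF that] \<open>j \<in> UNIV - {i}\<close>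
      by (simp add: neighbour_signal_def val_block_signal[OF that] block_diff_block)
    then show ?thesis
      by (intro hybrid_norm_extension; unfold dom dom_block_signal)
        (use htd htd' sub no_jump tk in blast)+
  qed
  moreover have "hybrid_norm (external_signal v) t k = hybrid_norm u t k"
  proof -
    have dom: "dom (external_signal v) = dom y"
      unfolding dom_v[symmetric] by (auto simp: external_signal_def)
    have "val (external_signal v) s l = val u s l" if "(s, l) \<in> dom x" for s l
      using v[OF that] by (simp add: external_signal_def)
    then show ?thesis
      by (intro hybrid_norm_extension; unfold dom solution_pairD(5)[OF sol])
        (use htd htd' sub no_jump tk in blast)+
  qed
  ultimately show ?thesis
    using y[OF tk] by simp
qed

section \<open>Construction of the overall stability functions\<close>

theorem theorem3p1:
  fixes W :: "('m::finite, 'n::finite, 'p::finite) network"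
    and \<sigma>h :: "'n \<Rightarrow> real \<Rightarrow> real"
    and \<gamma>h :: "'n \<Rightarrow> 'n \<Rightarrow> real \<Rightarrow> real"
    and \<gamma>uh :: "'n \<Rightarrow> real \<Rightarrow> real"
  assumes "CARD('n) \<ge> 2"
    and "hybrid_network W"
    and "\<And>i j. jump_sets W i = jump_sets W j"
    and "\<And>i. subsystem_pre_GS W i (\<sigma>h i) (\<gamma>h i) (\<gamma>uh i)"
    and "\<And>s :: real^'n. (\<forall>i. 0 \<le> s $ i) \<Longrightarrow> s \<noteq> 0 \<Longrightarrow>
           \<exists>i. Gamma_max (gain_matrix \<gamma>h) s $ i < s $ i"
  shows "\<exists>\<sigma> \<gamma>. overall_pre_GS W \<sigma> \<gamma>"
proof -
  have \<sigma>h: "class_Kinf0 (\<sigma>h i)" and \<gamma>uh: "class_Kinf0 (\<gamma>uh i)"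
    and \<gamma>h: "j \<noteq> i \<Longrightarrow> class_Kinf0 (\<gamma>h i j)" for i j
    using assms(4)[of i] by (auto simp: subsystem_pre_GS_def)
  note nonempty = UNIV_diff_singleton_nonempty[OF assms(1)]
  \<comment> \<open>Sums of nonnegative functions dominate each summand and, unlike maxima, need no
    case distinction. The identity makes the results members of \<open>class_Kinf\<close> even if
    all given functions vanish, and for \<open>g\<close> it also provides
    \<open>r \<le> g r\<close>.\<close>
  define \<sigma>0 where "\<sigma>0 r = r + (\<Sum>i\<in>UNIV. \<sigma>h i r)" for r
  define \<gamma>0 where "\<gamma>0 r = r + (\<Sum>i\<in>UNIV. \<gamma>uh i r)" for r
  define g where "g r = r + (\<Sum>(i, j)\<in>{(i, j). j \<noteq> i}. \<gamma>h i j r)" for r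
  \<comment> \<open>The factor \<open>CARD('n)\<close> comes from bounding the overall norm by the
    sum of the block norms. The exponent is that of \<open>small_gain_bound\<close> plus one for the
    final use of the subsystem estimate.\<close>
  define \<psi> where "\<psi> r = real CARD('n) * (g ^^ Suc (CARD('n))) r" for r
  have \<sigma>0: "class_Kinf \<sigma>0"
    unfolding \<sigma>0_def[abs_def] by (intro class_Kinf_add_sum class_Kinf_id \<sigma>h) auto
  have \<gamma>0: "class_Kinf \<gamma>0"
    unfolding \<gamma>0_def[abs_def] by (intro class_Kinf_add_sum class_Kinf_id \<gamma>uh) auto
  have g: "class_Kinf g"
  proof -
    have "class_Kinf (\<lambda>r. r + (\<Sum>p\<in>{(i, j). j \<noteq> i}. (\<lambda>p r. \<gamma>h (fst p) (snd p) r) p r))"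
      by (rule class_Kinf_add_sum) (auto intro: class_Kinf_id \<gamma>h)
    then show ?thesis
      by (simp add: g_def[abs_def] case_prod_beta)
  qed
  have \<psi>: "class_Kinf \<psi>"
    unfolding \<psi>_def[abs_def] by (intro class_Kinf_scale class_Kinf_funpow[OF g]) simp
  have \<sigma>h_le: "\<sigma>h i r \<le> \<sigma>0 r" and \<gamma>uh_le: "\<gamma>uh i r \<le> \<gamma>0 r" if "0 \<le> r" for i r
    using that member_le_sum[of i UNIV "\<lambda>i. \<sigma>h i r"] member_le_sum[of i UNIV "\<lambda>i. \<gamma>uh i r"]
      class_Kinf0_nonneg[OF \<sigma>h] class_Kinf0_nonneg[OF \<gamma>uh]
    by (auto simp: \<sigma>0_def \<gamma>0_def intro: add_increasing)
  have g_nonneg: "0 \<le> (\<lambda>(i, j). \<gamma>h i j r) p" if "p \<in> {(i, j). j \<noteq> i}" "0 \<le> r" for p r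
    using that class_Kinf0_nonneg[OF \<gamma>h] by auto
  have g_ge: "r \<le> g r" if "0 \<le> r" for r
  proof -
    have "0 \<le> (\<Sum>(i, j)\<in>{(i, j). j \<noteq> i}. \<gamma>h i j r)"
      by (intro sum_nonneg g_nonneg that)
    then show ?thesis
      by (simp add: g_def)
  qed
  have \<gamma>h_le: "\<gamma>h i j r \<le> g r" if "j \<noteq> i" "0 \<le> r" for i j r
    using member_le_sum[of "(i, j)" "{(i, j). j \<noteq> i}" "\<lambda>(i, j). \<gamma>h i j r"] that g_nonneg[OF _ that(2)]
    by (auto simp: g_def intro: add_increasing)
  have bound: "norm (val x t k) \<le> \<psi> (max (\<sigma>0 (norm (val x 0 0))) (\<gamma>0 (hybrid_norm u t k)))"
    if max: "maximal_solution_pair (overall W) x u" and tk: "(t, k) \<in> dom x" for x u t k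
  proof -
    have sol: "solution_pair (overall W) x u"
      using max by (simp add: maximal_solution_pair_def)
    let ?b = "block (owner W)"
    define s :: "real^'n" where "s = (\<chi> i. hybrid_norm (block_signal (owner W) i x) t k)"
    define c where "c = max (\<sigma>0 (norm (val x 0 0))) (\<gamma>0 (hybrid_norm u t k))"
    define M where "M i = (MAX j \<in> UNIV - {i}. \<gamma>h i j (s $ j))" for i
    have s: "0 \<le> s $ i" for i
      by (simp add: s_def hybrid_norm_nonneg)
    have c: "0 \<le> c"
      using class_Kinf0_nonneg[OF class_Kinf_imp_Kinf0[OF \<sigma>0], of "norm (val x 0 0)"]
      by (simp add: c_def)
    have input: "hybrid_input (block_signal (owner W) i x)" for i
      by (intro hybrid_arc_imp_input hybrid_arc_block_signal solution_pairD(1)[OF sol])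
    \<comment> \<open>The bound is uniform over all points up to \<open>(t, k)\<close>: monotonicity
      of the norms replaces those at \<open>(r, l)\<close> by those at \<open>(t, k)\<close>. Hence
      it bounds the norm \<open>s $ i\<close> and thereby closes the loop
      \<open>s $ i \<le> max c (M i)\<close>.\<close>
    have block_le: "norm (?b i (val x r l)) \<le> max c (M i)"
      if rl: "(r, l) \<in> dom x" "r + real l \<le> t + real k" for i r l
    proof -
      have "\<sigma>h i (norm (?b i (val x 0 0))) \<le> \<sigma>h i (norm (val x 0 0))"
        by (intro class_Kinf0_mono[OF \<sigma>h] norm_ge_zero norm_block_le)
      also have "\<dots> \<le> c"
        unfolding c_def by (intro max.coboundedI1 \<sigma>h_le norm_ge_zero)
      finally have 1: "\<sigma>h i (norm (?b i (val x 0 0))) \<le> c" .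
      have "\<gamma>uh i (hybrid_norm u r l) \<le> \<gamma>uh i (hybrid_norm u t k)"
        using tk solution_pairD(5)[OF sol] rl(2)
        by (intro class_Kinf0_mono[OF \<gamma>uh] hybrid_norm_nonneg hybrid_norm_mono
            solution_pairD(3)[OF sol]) simp_all
      also have "\<dots> \<le> c"
        unfolding c_def by (intro max.coboundedI2 \<gamma>uh_le hybrid_norm_nonneg)
      finally have 2: "\<gamma>uh i (hybrid_norm u r l) \<le> c" .
      have "\<gamma>h i j (hybrid_norm (block_signal (owner W) j x) r l) \<le> M i" if j: "j \<in> UNIV - {i}" for j
      proof -
        have "hybrid_norm (block_signal (owner W) j x) r l \<le> s $ j"
          unfolding s_def vec_lambda_beta
          by (intro hybrid_norm_mono input rl(2)) (simp only: dom_block_signal tk)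
        then have "\<gamma>h i j (hybrid_norm (block_signal (owner W) j x) r l) \<le> \<gamma>h i j (s $ j)"
          using j by (intro class_Kinf0_mono[OF \<gamma>h] hybrid_norm_nonneg) auto
        also have "\<dots> \<le> M i"
          unfolding M_def using j by (intro Max_ge) auto
        finally show ?thesis .
      qed
      then have "(MAX j \<in> UNIV - {i}. \<gamma>h i j (hybrid_norm (block_signal (owner W) j x) r l)) \<le> M i"
        using nonempty[of i] by (subst Max_le_iff) auto
      then show ?thesis
        using block_bound[OF assms(2,3,4) max rl(1), of i] 1 2 by linarith
    qed
    have "s $ i \<le> max c (M i)" for i
      unfolding s_def vec_lambda_beta
    proof (rule hybrid_norm_le[OF input])
      show "0 \<le> max c (M i)"
        using c by simp
      show "norm (val (block_signal (owner W) i x) r l) \<le> max c (M i)"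
        if "(r, l) \<in> dom (block_signal (owner W) i x)" "r + real l \<le> t + real k" for r l
        using that block_le val_block_signal unfolding dom_block_signal by metis
    qed
    then have s_le: "s $ i \<le> (g ^^ CARD('n)) c" for i
      using small_gain_bound[OF assms(1) \<gamma>h assms(5) g g_ge \<gamma>h_le s c] unfolding M_def by blast
    have gc: "0 \<le> (g ^^ m) c" "c \<le> (g ^^ m) c" for m
    proof -
      show nonneg: "0 \<le> (g ^^ m) c" for m
        using class_Kinf0_nonneg[OF class_Kinf_imp_Kinf0[OF class_Kinf_funpow[OF g]] c] .
      show "c \<le> (g ^^ m) c"
      proof (induction m)
        case (Suc m)
        then show ?case
          using g_ge[OF nonneg[of m]] by simp
      qed simp
    qed
    \<comment> \<open>The bound on \<open>s $ i\<close> does not control the value at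
      \<open>(t, k)\<close>, which may be invisible to the norm. It is therefore inserted into
      \<open>block_le\<close> at that point, where one more gain appears.\<close>
    have "\<gamma>h i j (s $ j) \<le> (g ^^ Suc (CARD('n))) c" if "j \<noteq> i" for i j
    proof -
      have "\<gamma>h i j (s $ j) \<le> \<gamma>h i j ((g ^^ CARD('n)) c)"
        using that by (intro class_Kinf0_mono[OF \<gamma>h] s s_le) auto
      also have "\<dots> \<le> (g ^^ Suc (CARD('n))) c"
        using \<gamma>h_le[OF that gc(1)] by simp
      finally show ?thesis .
    qed
    then have "M i \<le> (g ^^ Suc (CARD('n))) c" for i
      unfolding M_def using nonempty[of i] by (subst Max_le_iff) auto
    then have "norm (?b i (val x t k)) \<le> (g ^^ Suc (CARD('n))) c" for i
      using block_le[OF tk order_refl, of i] gc(2)[of "Suc (CARD('n))"] by (meson max.boundedI order_trans)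
    then have "(\<Sum>i\<in>UNIV. norm (?b i (val x t k))) \<le> \<psi> c"
      unfolding \<psi>_def by (intro sum_bounded_above) 
    then show ?thesis
      using norm_le_sum_block[of "val x t k" "owner W"] unfolding c_def by linarith
  qed
  have "overall_pre_GS W (\<lambda>r. \<psi> (\<sigma>0 r)) (\<lambda>r. \<psi> (\<gamma>0 r))"
    unfolding overall_pre_GS_def
  proof (intro conjI ballI, goal_cases)
    case 1
    show ?case
      by (rule class_Kinf_imp_Kinf0[OF class_Kinf_compose[OF \<psi> \<sigma>0]])
  next
    case 2
    show ?case
      by (rule class_Kinf_imp_Kinf0[OF class_Kinf_compose[OF \<psi> \<gamma>0]])
  next
    case (3 \<xi> p)
    show ?case
    proof (clarsimp split: prod.splits)
      fix x u t k y assume p: "p = (x, u)" and tk: "x (t, k) = Some y"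
      have "maximal_solution_pair (overall W) x u" "val x 0 0 = \<xi>"
        using 3(2) p by (auto simp: solutions_from_def)
      moreover have "(t, k) \<in> dom x"
        using tk by blast
      ultimately have "norm y \<le> \<psi> (max (\<sigma>0 (norm \<xi>)) (\<gamma>0 (hybrid_norm u t k)))"
        using bound[of x u t k] tk by simp
      \<comment> \<open>A nondecreasing function commutes with \<open>max\<close>; this separates
        the contributions of initial state and input.\<close>
      also have "\<dots> = max (\<psi> (\<sigma>0 (norm \<xi>))) (\<psi> (\<gamma>0 (hybrid_norm u t k)))"
        by (intro class_Kinf0_max class_Kinf_imp_Kinf0 \<psi> norm_ge_zero hybrid_norm_nonneg
            class_Kinf0_nonneg[OF class_Kinf_imp_Kinf0[OF \<sigma>0]]
            class_Kinf0_nonneg[OF class_Kinf_imp_Kinf0[OF \<gamma>0]])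
      finally show "norm y \<le> max (\<psi> (\<sigma>0 (norm \<xi>))) (\<psi> (\<gamma>0 (hybrid_norm u t k)))" .
    qed
  qed
  then show ?thesis
    by blast
qed

end
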